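(* Assume $\alpha=\gamma$, let $k\ge 3$ be fixed, and let $X_{C_k}$ be the number of labeled copies of the cycle $C_k$ in $K(n,P)$. Then the threshold for the appearance of $C_k$ in $K(n,P)$ is $(\alpha+\beta)^k+(\alpha-\beta)^k=1$; that is, if $(\alpha+\beta)^k+(\alpha-\beta)^k<1$ then a.a.s. $K(n,P)$ contains no copy of $C_k$, and if $(\alpha+\beta)^k+(\alpha-\beta)^k>1$ then a.a.s. \[X_{C_k}=(1+o(1))\left((\alpha+\beta)^k+(\alpha-\beta)^k\right)^n .\]
   Context: Let $0<\alpha,\beta,\gamma<1$ be constants not depending on $n$, and $P=\begin{pmatrix}\alpha&\beta\\ \beta&\gamma\end{pmatrix}$ indexed by $\{0,1\}$ ($P_{1,1}=\alpha$, $P_{0,1}=P_{1,0}=\beta$, $P_{0,0}=\gamma$). The stochastic Kronecker graph $K(n,P)$ has vertex set $\mathbb Z_2^n$; writing $u_k$ for the $k$-th digit of $u$, each pair $\{u,v\}$ is an edge with probability $p_{u,v}=\prod_{k=1}^n P_{u_k,v_k}$, independently of all other pairs. A labeled copy of a graph $G$ is an injective map $\varphi:V(G)\to\mathbb Z_2^n$ mapping every edge of $G$ to an edge of $K(n,P)$. A.a.s. (asymptotically almost surely) means with probability tending to $1$ as $n\to\infty$. *)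

theory Defs
  imports "HOL-Probability.Probability"
begin

text \<open>The index set \<open>{0,1}\<close> of the initiator matrix is encoded as \<open>bool\<close>, with \<open>True\<close> for 1,
  and a vertex in \<open>(\<int>/2)\<^sup>n\<close> is the list of its \<open>n\<close> digits.\<close>

definition initiator :: "real \<Rightarrow> real \<Rightarrow> real \<Rightarrow> bool \<Rightarrow> bool \<Rightarrow> real" where
  "initiator \<alpha> \<beta> \<gamma> a b = (if a \<and> b then \<alpha> else if \<not> a \<and> \<not> b then \<gamma> else \<beta>)"

definition kron_vertices :: "nat \<Rightarrow> bool list set" where
  "kron_vertices n = {u. length u = n}"

definition kron_prob :: "nat \<Rightarrow> (bool \<Rightarrow> bool \<Rightarrow> real) \<Rightarrow> bool list \<Rightarrow> bool list \<Rightarrow> real" where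
  "kron_prob n P u v = (\<Prod>k<n. P (u ! k) (v ! k))"

definition vertex_pairs :: "'v set \<Rightarrow> 'v set set" where
  "vertex_pairs V = {{u, v} | u v. u \<in> V \<and> v \<in> V \<and> u \<noteq> v}"

text \<open>Edges are unordered pairs, so this is well defined only for symmetric \<open>P\<close>;
  see \<open>kron_pair_prob_insert\<close>.\<close>

definition kron_pair_prob :: "nat \<Rightarrow> (bool \<Rightarrow> bool \<Rightarrow> real) \<Rightarrow> bool list set \<Rightarrow> real" where
  "kron_pair_prob n P e = (THE p. \<exists>u v. e = {u, v} \<and> p = kron_prob n P u v)"

lemma initiator_commute: "initiator \<alpha> \<beta> \<gamma> a b = initiator \<alpha> \<beta> \<gamma> b a"
  by (auto simp: initiator_def)

lemma kron_pair_prob_insert: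
  assumes "\<And>a b. P a b = P b a"
  shows "kron_pair_prob n P {u, v} = kron_prob n P u v"
proof -
  have comm: "kron_prob n P x y = kron_prob n P y x" for x y
    unfolding kron_prob_def by (rule prod.cong) (auto intro: assms)
  show ?thesis
    unfolding kron_pair_prob_def
    by (rule the_equality) (auto simp: doubleton_eq_iff intro: comm)
qed

text \<open>The distribution of the edge set of \<open>K(n,P)\<close>.\<close>

definition kronecker_graph :: "nat \<Rightarrow> (bool \<Rightarrow> bool \<Rightarrow> real) \<Rightarrow> bool list set set pmf" where
  "kronecker_graph n P =
     map_pmf (\<lambda>\<omega>. {e \<in> vertex_pairs (kron_vertices n). \<omega> e})
       (Pi_pmf (vertex_pairs (kron_vertices n)) False
          (\<lambda>e. bernoulli_pmf (kron_pair_prob n P e)))"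

definition labeled_copies ::
  "'a set \<Rightarrow> 'a set set \<Rightarrow> 'b set \<Rightarrow> 'b set set \<Rightarrow> ('a \<Rightarrow> 'b) set" where
  "labeled_copies V\<^sub>G E\<^sub>G V\<^sub>H E\<^sub>H =
     {\<phi> \<in> V\<^sub>G \<rightarrow>\<^sub>E V\<^sub>H. inj_on \<phi> V\<^sub>G \<and> (\<forall>e\<in>E\<^sub>G. \<phi> ` e \<in> E\<^sub>H)}"

definition cycle_vertices :: "nat \<Rightarrow> nat set" where
  "cycle_vertices k = {..<k}"

definition cycle_edges :: "nat \<Rightarrow> nat set set" where
  "cycle_edges k = {{i, Suc i mod k} | i. i < k}"

definition cycle_copies :: "nat \<Rightarrow> nat \<Rightarrow> bool list set set \<Rightarrow> (nat \<Rightarrow> bool list) set" where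
  "cycle_copies k n E = labeled_copies (cycle_vertices k) (cycle_edges k) (kron_vertices n) E"

definition aas :: "(nat \<Rightarrow> 'a pmf) \<Rightarrow> (nat \<Rightarrow> 'a \<Rightarrow> bool) \<Rightarrow> bool" where
  "aas M Q \<longleftrightarrow> (\<lambda>n. measure_pmf.prob (M n) {\<omega>. Q n \<omega>}) \<longlonglongrightarrow> 1"

end

theory Submission
  imports Defs
begin

text \<open>
  The total weight of all closed \<open>k\<close>-walks on the vertices factors over the \<open>n\<close> digits and is \<open>\<Lambda> ^ n\<close>, where
  \<open>\<Lambda>\<close> is the trace of the \<open>k\<close>-th power of the initiator. Walks in which two given vertices coincide
  contribute \<open>\<theta> ^ n\<close> with \<open>\<theta> < \<Lambda>\<close>, because digit patterns of positive weight are lost. Hence the expected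
  number of cycles is at most \<open>\<Lambda> ^ n\<close> and asymptotic to it, and the first moment method settles \<open>\<Lambda> < 1\<close>.

  Pairs of edge-disjoint cycles contribute at most \<open>\<Lambda> ^ (2 * n)\<close> to the second moment, and pairs with a
  given pattern of common edges contribute at most the \<open>n\<close>-th power of the same quantity for a single
  digit. So the number of cycles is concentrated as soon as all these quantities are less than \<open>\<Lambda>\<^sup>2\<close>.

  If \<open>\<alpha> = \<gamma>\<close>, the weight of a closed walk over one digit depends only on its steps in the group of order
  two, whose sum must vanish, and Fourier inversion gives \<open>\<Lambda> = s ^ k + d ^ k\<close> for \<open>s = \<alpha> + \<beta>\<close> and
  \<open>d = \<alpha> - \<beta>\<close>. For a pair of walks with \<open>j = k - l\<close> common edges, keep only that the steps along common
  edges agree, that both walks close up, and that they have one common vertex. As steps commute and equal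
  their inverses, the positions and directions of the common edges are then irrelevant, and Fourier
  inversion bounds the quantity in question by \<open>s ^ j * (s ^ (2 * l) + d ^ (2 * l)) / 2 + d ^ k * s ^ l\<close>, which
  is less than \<open>\<Lambda>\<^sup>2\<close> if \<open>\<Lambda> > 1\<close>.
\<close>

section \<open>Closed walks and their overlaps\<close>

definition cycle_edge :: "nat \<Rightarrow> (nat \<Rightarrow> 'v) \<Rightarrow> nat \<Rightarrow> 'v set" where
  "cycle_edge k \<phi> i = {\<phi> i, \<phi> (Suc i mod k)}"

definition closed_walk_weight :: "('v \<Rightarrow> 'v \<Rightarrow> real) \<Rightarrow> nat \<Rightarrow> (nat \<Rightarrow> 'v) \<Rightarrow> real" where
  "closed_walk_weight p k \<phi> = (\<Prod>i<k. p (\<phi> i) (\<phi> (Suc i mod k)))"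

definition closed_walk_sum :: "('v \<Rightarrow> 'v \<Rightarrow> real) \<Rightarrow> nat \<Rightarrow> real" where
  "closed_walk_sum p k = (\<Sum>\<phi>\<in>{..<k} \<rightarrow>\<^sub>E UNIV. closed_walk_weight p k \<phi>)"

definition self_meeting_sum :: "('v \<Rightarrow> 'v \<Rightarrow> real) \<Rightarrow> nat \<Rightarrow> nat \<Rightarrow> nat \<Rightarrow> real" where
  "self_meeting_sum p k i j = (\<Sum>\<phi> | \<phi> \<in> {..<k} \<rightarrow>\<^sub>E UNIV \<and> \<phi> i = \<phi> j. closed_walk_weight p k \<phi>)"

text \<open>An overlap pattern \<open>(M, r, s)\<close> of two \<open>k\<close>-cycles \<open>\<phi>\<close> and \<open>\<psi>\<close> is a matching \<open>M\<close> between the positions of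
  their common edges, together with one common vertex \<open>\<phi> r = \<psi> s\<close>. The directions in which \<open>\<phi>\<close> and \<open>\<psi>\<close>
  traverse the common edges need not be recorded.\<close>

definition overlap_patterns :: "nat \<Rightarrow> ((nat \<times> nat) set \<times> nat \<times> nat) set" where
  "overlap_patterns k =
     {(M, r, s). M \<subseteq> {..<k} \<times> {..<k} \<and> M \<noteq> {} \<and> inj_on fst M \<and> inj_on snd M \<and> r < k \<and> s < k}"

fun overlaps :: "nat \<Rightarrow> (nat \<times> nat) set \<times> nat \<times> nat \<Rightarrow> (nat \<Rightarrow> 'v) \<Rightarrow> (nat \<Rightarrow> 'v) \<Rightarrow> bool" where
  "overlaps k (M, r, s) \<phi> \<psi> \<longleftrightarrow>
     \<phi> r = \<psi> s \<and> (\<forall>(i, j)\<in>M. cycle_edge k \<phi> i = cycle_edge k \<psi> j)"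

definition union_weight ::
  "('v \<Rightarrow> 'v \<Rightarrow> real) \<Rightarrow> nat \<Rightarrow> (nat \<times> nat) set \<Rightarrow> (nat \<Rightarrow> 'v) \<Rightarrow> (nat \<Rightarrow> 'v) \<Rightarrow> real" where
  "union_weight p k M \<phi> \<psi> =
     closed_walk_weight p k \<phi> * (\<Prod>j\<in>{..<k} - snd ` M. p (\<psi> j) (\<psi> (Suc j mod k)))"

definition overlapping_walks ::
  "nat \<Rightarrow> 'v set \<Rightarrow> (nat \<times> nat) set \<times> nat \<times> nat \<Rightarrow> ((nat \<Rightarrow> 'v) \<times> (nat \<Rightarrow> 'v)) set" where
  "overlapping_walks k V \<pi> =
     {(\<phi>, \<psi>). \<phi> \<in> {..<k} \<rightarrow>\<^sub>E V \<and> \<psi> \<in> {..<k} \<rightarrow>\<^sub>E V \<and> overlaps k \<pi> \<phi> \<psi>}"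

definition overlap_sum ::
  "('v \<Rightarrow> 'v \<Rightarrow> real) \<Rightarrow> nat \<Rightarrow> (nat \<times> nat) set \<times> nat \<times> nat \<Rightarrow> real" where
  "overlap_sum p k \<pi> = (\<Sum>(\<phi>, \<psi>)\<in>overlapping_walks k UNIV \<pi>. union_weight p k (fst \<pi>) \<phi> \<psi>)"

lemma finite_overlap_patterns: "finite (overlap_patterns k)"
  by (rule finite_subset[of _ "Pow ({..<k} \<times> {..<k}) \<times> {..<k} \<times> {..<k}"])
    (auto simp: overlap_patterns_def)

lemma closed_walk_weight_nonneg:
  "(\<And>a b. 0 \<le> p a b) \<Longrightarrow> 0 \<le> closed_walk_weight p k \<phi>"
  by (simp add: closed_walk_weight_def prod_nonneg)

lemma self_meeting_sum_nonneg:
  "(\<And>a b. 0 \<le> p a b) \<Longrightarrow> 0 \<le> self_meeting_sum p k i j"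
  by (simp add: self_meeting_sum_def sum_nonneg closed_walk_weight_nonneg)

lemma self_meeting_sum_less:
  fixes p :: "'v::finite \<Rightarrow> 'v \<Rightarrow> real" and a b :: 'v
  assumes "i < k" "j < k" "i \<noteq> j" and pos: "\<And>a b. 0 < p a b" and "a \<noteq> b"
  shows "self_meeting_sum p k i j < closed_walk_sum p k"
  unfolding self_meeting_sum_def closed_walk_sum_def
proof (rule sum_strict_mono2)
  let ?\<phi> = "\<lambda>l\<in>{..<k}. if l = i then a else b"
  show "?\<phi> \<in> ({..<k} \<rightarrow>\<^sub>E UNIV) - {\<phi> \<in> {..<k} \<rightarrow>\<^sub>E UNIV. \<phi> i = \<phi> j}"
    using assms(1-3,5) by simp
  show "0 < closed_walk_weight p k ?\<phi>" "0 \<le> closed_walk_weight p k \<phi>" for \<phi>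
    using pos by (auto simp: closed_walk_weight_def less_imp_le intro!: prod_pos prod_nonneg)
qed (auto simp: finite_PiE)

lemma union_weight_nonneg:
  "(\<And>a b. 0 \<le> p a b) \<Longrightarrow> 0 \<le> union_weight p k M \<phi> \<psi>"
  by (simp add: union_weight_def closed_walk_weight_nonneg prod_nonneg)

lemma union_weight_empty:
  "union_weight p k {} \<phi> \<psi> = closed_walk_weight p k \<phi> * closed_walk_weight p k \<psi>"
  by (simp add: union_weight_def closed_walk_weight_def)

lemma overlap_sum_nonneg:
  "(\<And>a b. 0 \<le> p a b) \<Longrightarrow> 0 \<le> overlap_sum p k \<pi>"
  by (auto simp: overlap_sum_def intro!: sum_nonneg union_weight_nonneg)

lemma overlap_sum_eq_sum_of_bool:
  fixes p :: "'v::finite \<Rightarrow> 'v \<Rightarrow> real"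
  shows "overlap_sum p k \<pi> = (\<Sum>\<phi>\<in>{..<k} \<rightarrow>\<^sub>E UNIV. \<Sum>\<psi>\<in>{..<k} \<rightarrow>\<^sub>E UNIV.
    of_bool (overlaps k \<pi> \<phi> \<psi>) * union_weight p k (fst \<pi>) \<phi> \<psi>)"
proof -
  let ?B = "({..<k} \<rightarrow>\<^sub>E (UNIV :: 'v set)) \<times> ({..<k} \<rightarrow>\<^sub>E (UNIV :: 'v set))"
  let ?w = "\<lambda>x. union_weight p k (fst \<pi>) (fst x) (snd x)"
  have "overlapping_walks k UNIV \<pi> = {x \<in> ?B. overlaps k \<pi> (fst x) (snd x)}"
    by (simp add: overlapping_walks_def set_eq_iff)
  then have "overlap_sum p k \<pi> = sum ?w {x \<in> ?B. overlaps k \<pi> (fst x) (snd x)}"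
    by (simp add: overlap_sum_def case_prod_unfold)
  also have "\<dots> = (\<Sum>x\<in>?B. if overlaps k \<pi> (fst x) (snd x) then ?w x else 0)"
    by (rule sum.inter_filter) (simp add: finite_PiE)
  also have "\<dots> = (\<Sum>(\<phi>, \<psi>)\<in>?B. of_bool (overlaps k \<pi> \<phi> \<psi>) * union_weight p k (fst \<pi>) \<phi> \<psi>)"
    by (intro sum.cong refl) (simp add: case_prod_unfold)
  finally show ?thesis
    by (simp add: sum.cartesian_product)
qed

lemma finite_overlapping_walks: "finite V \<Longrightarrow> finite (overlapping_walks k V \<pi>)"
  by (rule finite_subset[of _ "({..<k} \<rightarrow>\<^sub>E V) \<times> ({..<k} \<rightarrow>\<^sub>E V)"])
    (auto simp: overlapping_walks_def finite_PiE)

lemma Suc_mod_eq_if: "i < k \<Longrightarrow> Suc i mod k = (if Suc i = k then 0 else Suc i)"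
  by simp

lemma inj_on_cycle_edge:
  assumes "inj_on \<phi> {..<k}" "3 \<le> k"
  shows "inj_on (cycle_edge k \<phi>) {..<k}"
proof (rule inj_onI)
  fix i j assume ij: "i \<in> {..<k}" "j \<in> {..<k}" and eq: "cycle_edge k \<phi> i = cycle_edge k \<phi> j"
  have "\<phi> ` {i, Suc i mod k} = \<phi> ` {j, Suc j mod k}"
    using eq by (simp add: cycle_edge_def)
  moreover have "{i, Suc i mod k} \<subseteq> {..<k}" "{j, Suc j mod k} \<subseteq> {..<k}"
    using ij assms(2) by auto
  ultimately have "{i, Suc i mod k} = {j, Suc j mod k}"
    using inj_on_image_eq_iff[OF assms(1)] by blast
  then consider "i = j" | "i = Suc j mod k" "j = Suc i mod k"
    by (auto simp: doubleton_eq_iff)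
  then show "i = j"
    by cases (use ij assms(2) in \<open>auto simp: Suc_mod_eq_if split: if_splits\<close>)
qed

section \<open>Factorisation over digits\<close>

definition digit :: "'i set \<Rightarrow> nat \<Rightarrow> ('i \<Rightarrow> 'a list) \<Rightarrow> 'i \<Rightarrow> 'a" where
  "digit A c \<phi> = (\<lambda>i\<in>A. \<phi> i ! c)"

lemma sum_prod_digit:
  fixes f :: "nat \<Rightarrow> ('i \<Rightarrow> 'a::finite) \<Rightarrow> 'b::comm_semiring_1"
  assumes "finite A"
  shows "(\<Sum>\<phi>\<in>A \<rightarrow>\<^sub>E {u. length u = n}. \<Prod>c<n. f c (digit A c \<phi>)) = (\<Prod>c<n. \<Sum>\<sigma>\<in>A \<rightarrow>\<^sub>E UNIV. f c \<sigma>)"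
proof -
  have "(\<Prod>c<n. \<Sum>\<sigma>\<in>A \<rightarrow>\<^sub>E UNIV. f c \<sigma>) = (\<Sum>\<rho>\<in>{..<n} \<rightarrow>\<^sub>E (A \<rightarrow>\<^sub>E UNIV). \<Prod>c<n. f c (\<rho> c))"
    using assms by (intro prod_sum_PiE finite_PiE) auto
  also have "\<dots> = (\<Sum>\<phi>\<in>A \<rightarrow>\<^sub>E {u. length u = n}. \<Prod>c<n. f c (digit A c \<phi>))"
  proof (rule sum.reindex_bij_witness
      [where i = "\<lambda>\<phi>. \<lambda>c\<in>{..<n}. digit A c \<phi>" and j = "\<lambda>\<rho>. \<lambda>i\<in>A. map (\<lambda>c. \<rho> c i) [0..<n]"])
    fix \<rho> :: "nat \<Rightarrow> 'i \<Rightarrow> 'a" assume \<rho>: "\<rho> \<in> {..<n} \<rightarrow>\<^sub>E (A \<rightarrow>\<^sub>E UNIV)"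
    let ?\<phi> = "\<lambda>i\<in>A. map (\<lambda>c. \<rho> c i) [0..<n]"
    have digit: "digit A c ?\<phi> = \<rho> c" if "c < n" for c
    proof -
      have "digit A c ?\<phi> = restrict (\<rho> c) A"
        unfolding digit_def using that by (intro restrict_ext) simp
      also have "\<dots> = \<rho> c"
        using PiE_mem[OF \<rho>] that by (intro PiE_restrict) auto
      finally show ?thesis .
    qed
    then have "(\<lambda>c\<in>{..<n}. digit A c ?\<phi>) = restrict \<rho> {..<n}"
      by (intro restrict_ext) simp
    with \<rho> show "(\<lambda>c\<in>{..<n}. digit A c ?\<phi>) = \<rho>"
      by (simp add: PiE_restrict)
    show "?\<phi> \<in> A \<rightarrow>\<^sub>E {u. length u = n}"
      by auto
    show "(\<Prod>c<n. f c (digit A c ?\<phi>)) = (\<Prod>c<n. f c (\<rho> c))"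
      using digit by simp
  next
    fix \<phi> :: "'i \<Rightarrow> 'a list" assume \<phi>: "\<phi> \<in> A \<rightarrow>\<^sub>E {u. length u = n}"
    have "map (\<lambda>c. (\<lambda>c\<in>{..<n}. digit A c \<phi>) c i) [0..<n] = \<phi> i" if "i \<in> A" for i
      using PiE_mem[OF \<phi> that] that by (intro nth_equalityI) (auto simp: digit_def)
    then have "(\<lambda>i\<in>A. map (\<lambda>c. (\<lambda>c\<in>{..<n}. digit A c \<phi>) c i) [0..<n]) = restrict \<phi> A"
      by (intro restrict_ext)
    with \<phi> show "(\<lambda>i\<in>A. map (\<lambda>c. (\<lambda>c\<in>{..<n}. digit A c \<phi>) c i) [0..<n]) = \<phi>"
      by (simp only: PiE_restrict)
    show "(\<lambda>c\<in>{..<n}. digit A c \<phi>) \<in> {..<n} \<rightarrow>\<^sub>E (A \<rightarrow>\<^sub>E UNIV)"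
      by (auto simp: digit_def)
  qed
  finally show ?thesis ..
qed

lemma sum_sum_prod_digit:
  fixes f :: "('i \<Rightarrow> 'a::finite) \<Rightarrow> ('j \<Rightarrow> 'b::finite) \<Rightarrow> 'c::comm_semiring_1"
  assumes "finite A" "finite B"
  shows "(\<Sum>\<phi>\<in>A \<rightarrow>\<^sub>E {u. length u = n}. \<Sum>\<psi>\<in>B \<rightarrow>\<^sub>E {u. length u = n}. \<Prod>c<n. f (digit A c \<phi>) (digit B c \<psi>)) =
    (\<Sum>\<sigma>\<in>A \<rightarrow>\<^sub>E UNIV. \<Sum>\<tau>\<in>B \<rightarrow>\<^sub>E UNIV. f \<sigma> \<tau>) ^ n"
  using sum_prod_digit[OF assms(2), where f = "\<lambda>c. f (digit A c _)"]
    sum_prod_digit[OF assms(1), where f = "\<lambda>_ \<sigma>. \<Sum>\<tau>\<in>B \<rightarrow>\<^sub>E UNIV. f \<sigma> \<tau>"]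
  by simp

lemma finite_kron_vertices: "finite (kron_vertices n)"
  using finite_lists_length_eq[of "UNIV :: bool set" n] by (simp add: kron_vertices_def)

lemma closed_walk_weight_kron_prob:
  assumes "0 < k"
  shows "closed_walk_weight (kron_prob n P) k \<phi> = (\<Prod>c<n. closed_walk_weight P k (digit {..<k} c \<phi>))"
  unfolding closed_walk_weight_def kron_prob_def
  using assms by (subst prod.swap) (simp add: digit_def)

lemma union_weight_kron_prob:
  assumes "0 < k"
  shows "union_weight (kron_prob n P) k M \<phi> \<psi> =
    (\<Prod>c<n. union_weight P k M (digit {..<k} c \<phi>) (digit {..<k} c \<psi>))"
proof -
  have "(\<Prod>j\<in>{..<k} - snd ` M. kron_prob n P (\<psi> j) (\<psi> (Suc j mod k))) =
      (\<Prod>c<n. \<Prod>j\<in>{..<k} - snd ` M. P (digit {..<k} c \<psi> j) (digit {..<k} c \<psi> (Suc j mod k)))"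
    unfolding kron_prob_def using assms by (subst prod.swap) (simp add: digit_def)
  then show ?thesis
    by (simp add: union_weight_def closed_walk_weight_kron_prob[OF assms] prod.distrib)
qed

lemma sum_closed_walk_weight_kron_prob:
  assumes "0 < k"
  shows "(\<Sum>\<phi>\<in>{..<k} \<rightarrow>\<^sub>E kron_vertices n. closed_walk_weight (kron_prob n P) k \<phi>) = closed_walk_sum P k ^ n"
  using sum_prod_digit[of "{..<k}" "\<lambda>_. closed_walk_weight P k" n]
  by (simp add: closed_walk_weight_kron_prob[OF assms] closed_walk_sum_def kron_vertices_def)

lemma sum_self_meeting_walks_kron_prob:
  assumes "i < k" "j < k"
  shows "(\<Sum>\<phi> | \<phi> \<in> {..<k} \<rightarrow>\<^sub>E kron_vertices n \<and> \<phi> i = \<phi> j. closed_walk_weight (kron_prob n P) k \<phi>) =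
    self_meeting_sum P k i j ^ n"
proof -
  have meet_iff: "\<phi> i = \<phi> j \<longleftrightarrow> (\<forall>c<n. digit {..<k} c \<phi> i = digit {..<k} c \<phi> j)"
    if "\<phi> \<in> {..<k} \<rightarrow>\<^sub>E {u. length u = n}" for \<phi> :: "nat \<Rightarrow> bool list"
    using PiE_mem[OF that, of i] PiE_mem[OF that, of j] assms
    by (auto simp: digit_def list_eq_iff_nth_eq)
  have of_bool_all: "of_bool (\<forall>c<n. Q c) = (\<Prod>c<n. of_bool (Q c) :: real)" for Q
    by (induction n) (auto simp: less_Suc_eq)
  have "(\<Sum>\<phi> | \<phi> \<in> {..<k} \<rightarrow>\<^sub>E kron_vertices n \<and> \<phi> i = \<phi> j. closed_walk_weight (kron_prob n P) k \<phi>) =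
      (\<Sum>\<phi>\<in>{..<k} \<rightarrow>\<^sub>E kron_vertices n. of_bool (\<phi> i = \<phi> j) * closed_walk_weight (kron_prob n P) k \<phi>)"
    by (intro sum.mono_neutral_cong_left finite_PiE) (auto simp: finite_kron_vertices)
  also have "\<dots> = (\<Sum>\<phi>\<in>{..<k} \<rightarrow>\<^sub>E {u. length u = n}.
      \<Prod>c<n. of_bool (digit {..<k} c \<phi> i = digit {..<k} c \<phi> j) * closed_walk_weight P k (digit {..<k} c \<phi>))"
    unfolding kron_vertices_def using assms
    by (intro sum.cong refl) (simp add: meet_iff of_bool_all closed_walk_weight_kron_prob prod.distrib)
  also have "\<dots> = (\<Sum>\<sigma>\<in>{..<k} \<rightarrow>\<^sub>E UNIV. of_bool (\<sigma> i = \<sigma> j) * closed_walk_weight P k \<sigma>) ^ n"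
    using sum_prod_digit[of "{..<k}" "\<lambda>_ \<sigma>. of_bool (\<sigma> i = \<sigma> j) * closed_walk_weight P k \<sigma>" n] by simp
  also have "(\<Sum>\<sigma>\<in>{..<k} \<rightarrow>\<^sub>E UNIV. of_bool (\<sigma> i = \<sigma> j) * closed_walk_weight P k \<sigma>) =
      self_meeting_sum P k i j"
    unfolding self_meeting_sum_def by (intro sum.mono_neutral_cong_right finite_PiE) auto
  finally show ?thesis .
qed

lemma overlaps_digit:
  assumes "\<pi> \<in> overlap_patterns k" "overlaps k \<pi> \<phi> \<psi>"
  shows "overlaps k \<pi> (digit {..<k} c \<phi>) (digit {..<k} c \<psi>)"
proof -
  obtain M r s where \<pi>_eq: "\<pi> = (M, r, s)"
    by (cases \<pi>)
  have positions: "M \<subseteq> {..<k} \<times> {..<k}" "r < k" "s < k"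
    using assms(1) by (auto simp: \<pi>_eq overlap_patterns_def)
  have cycle_edge_digit: "cycle_edge k (digit {..<k} c \<xi>) i = (\<lambda>u. u ! c) ` cycle_edge k \<xi> i"
    if "i < k" for \<xi> :: "nat \<Rightarrow> 'a list" and i
    using that by (simp add: cycle_edge_def digit_def)
  have "\<phi> r = \<psi> s" and edges: "\<forall>(i, j)\<in>M. cycle_edge k \<phi> i = cycle_edge k \<psi> j"
    using assms(2) by (auto simp: \<pi>_eq)
  then have "digit {..<k} c \<phi> r = digit {..<k} c \<psi> s"
    using positions by (simp add: digit_def)
  moreover have "cycle_edge k (digit {..<k} c \<phi>) i = cycle_edge k (digit {..<k} c \<psi>) j"
    if "(i, j) \<in> M" for i j
  proof -
    have "i < k" "j < k" "cycle_edge k \<phi> i = cycle_edge k \<psi> j"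
      using positions edges that by auto
    then show ?thesis
      by (simp add: cycle_edge_digit)
  qed
  ultimately show ?thesis
    unfolding \<pi>_eq by auto
qed

lemma sum_overlapping_walks_kron_prob_le:
  assumes "\<pi> \<in> overlap_patterns k" and nonneg: "\<And>a b. 0 \<le> P a b"
  shows "(\<Sum>(\<phi>, \<psi>)\<in>overlapping_walks k (kron_vertices n) \<pi>.
      union_weight (kron_prob n P) k (fst \<pi>) \<phi> \<psi>) \<le> overlap_sum P k \<pi> ^ n"
    (is "sum ?w ?S \<le> _")
proof -
  let ?A = "{..<k} \<rightarrow>\<^sub>E {u :: bool list. length u = n}"
  let ?f = "\<lambda>\<sigma> \<tau>. of_bool (overlaps k \<pi> \<sigma> \<tau>) * union_weight P k (fst \<pi>) \<sigma> \<tau>"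
  let ?F = "\<lambda>(\<phi>, \<psi>). \<Prod>c<n. ?f (digit {..<k} c \<phi>) (digit {..<k} c \<psi>)"
  have "0 < k"
    using assms(1) by (auto simp: overlap_patterns_def)
  have "sum ?w ?S = sum ?F ?S"
  proof (intro sum.cong refl)
    fix x assume "x \<in> ?S"
    then obtain \<phi> \<psi> where x_eq: "x = (\<phi>, \<psi>)" and "overlaps k \<pi> \<phi> \<psi>"
      by (auto simp: overlapping_walks_def)
    then have "overlaps k \<pi> (digit {..<k} c \<phi>) (digit {..<k} c \<psi>)" for c
      by (simp add: overlaps_digit[OF assms(1)])
    then show "?w x = ?F x"
      by (simp add: x_eq union_weight_kron_prob[OF \<open>0 < k\<close>])
  qed
  also have "\<dots> \<le> sum ?F (?A \<times> ?A)"
  proof (rule sum_mono2)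
    show "finite (?A \<times> ?A)"
      using finite_kron_vertices by (intro finite_cartesian_product finite_PiE) (auto simp: kron_vertices_def)
    show "?S \<subseteq> ?A \<times> ?A"
      by (auto simp: overlapping_walks_def kron_vertices_def)
    show "0 \<le> ?F x" for x
      using nonneg by (cases x) (simp add: prod_nonneg union_weight_nonneg)
  qed
  also have "\<dots> = overlap_sum P k \<pi> ^ n"
    using sum_sum_prod_digit[of "{..<k}" "{..<k}" ?f n]
    by (simp add: overlap_sum_eq_sum_of_bool sum.cartesian_product)
  finally show ?thesis .
qed

section \<open>Concentration of random variables\<close>

lemma expectation_of_bool:
  "measure_pmf.expectation M (\<lambda>\<omega>. of_bool (Q \<omega>)) = measure_pmf.prob M {\<omega>. Q \<omega>}"
proof -
  have "(\<lambda>\<omega>. of_bool (Q \<omega>) :: real) = indicator {\<omega>. Q \<omega>}"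
    by (auto simp: indicator_def)
  then show ?thesis
    by simp
qed

lemma prob_Collect_not:
  "measure_pmf.prob M {\<omega>. \<not> Q \<omega>} = 1 - measure_pmf.prob M {\<omega>. Q \<omega>}"
  using measure_pmf.prob_compl[of "{\<omega>. Q \<omega>}" M] by (simp add: Collect_neg_eq Compl_eq_Diff_UNIV)

lemma tendsto_sum_power_zero:
  fixes \<theta> :: "'i \<Rightarrow> real"
  assumes "\<And>x. x \<in> A \<Longrightarrow> 0 \<le> \<theta> x" "\<And>x. x \<in> A \<Longrightarrow> \<theta> x < 1"
  shows "(\<lambda>n. \<Sum>x\<in>A. \<theta> x ^ n) \<longlonglongrightarrow> 0"
  using tendsto_sum[of A "\<lambda>x n. \<theta> x ^ n" "\<lambda>_. 0" sequentially] assms by (simp add: LIMSEQ_power_zero)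

lemma aasI_prob_ge:
  assumes "\<And>n. 1 - \<epsilon> n \<le> measure_pmf.prob (M n) {\<omega>. Q n \<omega>}" and "\<epsilon> \<longlonglongrightarrow> 0"
  shows "aas M Q"
  unfolding aas_def
proof (rule tendsto_sandwich)
  show "(\<lambda>n. 1 - \<epsilon> n) \<longlonglongrightarrow> 1"
    using tendsto_diff[OF tendsto_const[of 1] assms(2)] by simp
qed (use assms(1) in auto)

lemma second_moment_imp_aas:
  fixes X :: "nat \<Rightarrow> 'a \<Rightarrow> real"
  assumes finite_support: "\<And>n. finite (set_pmf (M n))" and a_nonzero: "\<And>n. a n \<noteq> 0"
    and moment: "(\<lambda>n. measure_pmf.expectation (M n) (\<lambda>\<omega>. (X n \<omega> / a n - 1)\<^sup>2)) \<longlonglongrightarrow> 0"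
  shows "\<exists>\<delta>. \<delta> \<longlonglongrightarrow> 0 \<and> aas M (\<lambda>n \<omega>. \<exists>\<eta>. \<bar>\<eta>\<bar> \<le> \<delta> n \<and> X n \<omega> = (1 + \<eta>) * a n)"
proof (intro exI conjI)
  \<comment> \<open>The summand \<open>(1 / 2) ^ n\<close> keeps the tolerance positive where the second moment vanishes.\<close>
  define v where "v n = measure_pmf.expectation (M n) (\<lambda>\<omega>. (X n \<omega> / a n - 1)\<^sup>2) + (1 / 2) ^ n" for n
  define \<delta> where "\<delta> n = sqrt (sqrt (v n))" for n
  have v_tendsto: "v \<longlonglongrightarrow> 0"
    unfolding v_def using tendsto_add[OF moment LIMSEQ_power_zero[of "1 / 2 :: real"]] by simp
  have v_pos: "0 < v n" for n
    unfolding v_def by (intro add_nonneg_pos integral_nonneg) auto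
  have sqrt_v_tendsto: "(\<lambda>n. sqrt (v n)) \<longlonglongrightarrow> 0"
    using tendsto_real_sqrt[OF v_tendsto] by simp
  then show "\<delta> \<longlonglongrightarrow> 0"
    unfolding \<delta>_def using tendsto_real_sqrt[OF sqrt_v_tendsto] by simp
  show "aas M (\<lambda>n \<omega>. \<exists>\<eta>. \<bar>\<eta>\<bar> \<le> \<delta> n \<and> X n \<omega> = (1 + \<eta>) * a n)"
  proof (rule aasI_prob_ge[OF _ sqrt_v_tendsto])
    fix n
    have "measure_pmf.prob (M n) {\<omega>. \<delta> n \<le> \<bar>X n \<omega> / a n - 1\<bar>} \<le>
        measure_pmf.expectation (M n) (\<lambda>\<omega>. (X n \<omega> / a n - 1)\<^sup>2) / (\<delta> n)\<^sup>2"
      using measure_pmf.second_moment_method[of "\<lambda>\<omega>. X n \<omega> / a n - 1" "M n" "\<delta> n"] v_pos[of n]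
      by (simp add: \<delta>_def integrable_measure_pmf_finite finite_support)
    also have "\<dots> \<le> v n / sqrt (v n)"
      using v_pos[of n] by (simp add: \<delta>_def v_def divide_right_mono)
    also have "\<dots> = sqrt (v n)"
      using v_pos[of n] by (simp add: real_div_sqrt)
    finally have "1 - sqrt (v n) \<le> measure_pmf.prob (M n) {\<omega>. \<not> \<delta> n \<le> \<bar>X n \<omega> / a n - 1\<bar>}"
      unfolding prob_Collect_not by simp
    also have "\<dots> \<le> measure_pmf.prob (M n) {\<omega>. \<exists>\<eta>. \<bar>\<eta>\<bar> \<le> \<delta> n \<and> X n \<omega> = (1 + \<eta>) * a n}"
      using a_nonzero[of n] by (intro measure_pmf.finite_measure_mono) (auto intro!: exI[of _ "X n _ / a n - 1"])
    finally show "1 - sqrt (v n) \<le> measure_pmf.prob (M n) {\<omega>. \<exists>\<eta>. \<bar>\<eta>\<bar> \<le> \<delta> n \<and> X n \<omega> = (1 + \<eta>) * a n}" .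
  qed
qed

section \<open>Moments of the number of cycles\<close>

definition cycle_embeddings :: "nat \<Rightarrow> nat \<Rightarrow> (nat \<Rightarrow> bool list) set" where
  "cycle_embeddings k n = {\<phi> \<in> {..<k} \<rightarrow>\<^sub>E kron_vertices n. inj_on \<phi> {..<k}}"

lemma finite_cycle_embeddings: "finite (cycle_embeddings k n)"
  by (rule finite_subset[of _ "{..<k} \<rightarrow>\<^sub>E kron_vertices n"])
    (auto simp: cycle_embeddings_def finite_kron_vertices finite_PiE)

lemma cycle_copies_eq:
  "cycle_copies k n E = {\<phi> \<in> cycle_embeddings k n. cycle_edge k \<phi> ` {..<k} \<subseteq> E}"
proof -
  have "cycle_edges k = (\<lambda>i. {i, Suc i mod k}) ` {..<k}"
    by (auto simp: cycle_edges_def)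
  then show ?thesis
    by (auto simp: cycle_copies_def labeled_copies_def cycle_embeddings_def cycle_vertices_def cycle_edge_def)
qed

lemma card_cycle_copies:
  "real (card (cycle_copies k n E)) = (\<Sum>\<phi>\<in>cycle_embeddings k n. of_bool (cycle_edge k \<phi> ` {..<k} \<subseteq> E))"
  using finite_cycle_embeddings[of k n] by (simp add: cycle_copies_eq Int_def)

lemma cycle_edges_subset_vertex_pairs:
  assumes "\<phi> \<in> cycle_embeddings k n" "2 \<le> k"
  shows "cycle_edge k \<phi> ` {..<k} \<subseteq> vertex_pairs (kron_vertices n)"
proof (rule image_subsetI)
  fix i assume i: "i \<in> {..<k}"
  then have "Suc i mod k \<in> {..<k}" "Suc i mod k \<noteq> i"
    using assms(2) by (auto simp: Suc_mod_eq_if)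
  then have "\<phi> i \<in> kron_vertices n" "\<phi> (Suc i mod k) \<in> kron_vertices n" "\<phi> i \<noteq> \<phi> (Suc i mod k)"
    using assms(1) i inj_on_eq_iff[of \<phi> "{..<k}" i "Suc i mod k"] by (simp_all add: cycle_embeddings_def PiE_iff)
  then show "cycle_edge k \<phi> i \<in> vertex_pairs (kron_vertices n)"
    unfolding cycle_edge_def vertex_pairs_def by blast
qed

lemma finite_vertex_pairs: "finite V \<Longrightarrow> finite (vertex_pairs V)"
  by (rule finite_subset[of _ "Pow V"]) (auto simp: vertex_pairs_def)

lemma finite_set_kronecker_graph: "finite (set_pmf (kronecker_graph n P))"
  by (rule finite_subset[of _ "Pow (vertex_pairs (kron_vertices n))"])
    (auto simp: kronecker_graph_def finite_vertex_pairs finite_kron_vertices)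

lemma integrable_kronecker_graph: "integrable (measure_pmf (kronecker_graph n P)) (f :: _ \<Rightarrow> real)"
  by (rule integrable_measure_pmf_finite[OF finite_set_kronecker_graph])

definition distinct_positions :: "nat \<Rightarrow> (nat \<times> nat) set" where
  "distinct_positions k = {(i, j). i < k \<and> j < k \<and> i \<noteq> j}"

lemma finite_distinct_positions: "finite (distinct_positions k)"
  by (rule finite_subset[of _ "{..<k} \<times> {..<k}"]) (auto simp: distinct_positions_def)

definition shared_positions :: "nat \<Rightarrow> (nat \<Rightarrow> 'v) \<Rightarrow> (nat \<Rightarrow> 'v) \<Rightarrow> (nat \<times> nat) set" where
  "shared_positions k \<phi> \<psi> = {(i, j). i < k \<and> j < k \<and> cycle_edge k \<phi> i = cycle_edge k \<psi> j}"

lemma shared_positions_overlap_pattern: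
  assumes "inj_on \<phi> {..<k}" "inj_on \<psi> {..<k}" "3 \<le> k" and "shared_positions k \<phi> \<psi> \<noteq> {}"
  obtains \<pi> where "\<pi> \<in> overlap_patterns k" "fst \<pi> = shared_positions k \<phi> \<psi>" "overlaps k \<pi> \<phi> \<psi>"
proof -
  let ?M = "shared_positions k \<phi> \<psi>"
  obtain r j where positions: "r < k" "j < k" and "cycle_edge k \<phi> r = cycle_edge k \<psi> j"
    using assms(4) by (auto simp: shared_positions_def)
  then obtain s where common_vertex: "s < k" "\<phi> r = \<psi> s"
    by (auto simp: cycle_edge_def doubleton_eq_iff intro: that[of j] that[of "Suc j mod k"])
  have "inj_on fst ?M" "inj_on snd ?M"
    using inj_on_cycle_edge[OF assms(1,3)] inj_on_cycle_edge[OF assms(2,3)]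
    by (auto simp: shared_positions_def inj_on_def)
  then have "(?M, r, s) \<in> overlap_patterns k"
    using assms(4) positions(1) common_vertex(1) by (auto simp: overlap_patterns_def shared_positions_def)
  moreover have "overlaps k (?M, r, s) \<phi> \<psi>"
    using common_vertex(2) by (auto simp: shared_positions_def)
  ultimately show ?thesis
    using that by force
qed

locale stochastic_kronecker =
  fixes P :: "bool \<Rightarrow> bool \<Rightarrow> real"
  assumes P_commute: "P a b = P b a" and P_pos: "0 < P a b" and P_le_1: "P a b \<le> 1"
begin

lemma P_nonneg: "0 \<le> P a b"
  using P_pos by (rule less_imp_le)

lemma kron_prob_nonneg: "0 \<le> kron_prob n P u v"
  by (simp add: kron_prob_def prod_nonneg P_nonneg)

lemma closed_walk_sum_pos: "0 < closed_walk_sum P k"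
  unfolding closed_walk_sum_def closed_walk_weight_def
  by (intro sum_pos prod_pos) (auto simp: P_pos finite_PiE PiE_eq_empty_iff)

lemma prob_edges_subset:
  assumes S_subset: "S \<subseteq> vertex_pairs (kron_vertices n)"
  shows "measure_pmf.prob (kronecker_graph n P) {E. S \<subseteq> E} = (\<Prod>e\<in>S. kron_pair_prob n P e)"
proof -
  let ?U = "vertex_pairs (kron_vertices n)"
  have finite_pairs: "finite ?U"
    by (simp add: finite_vertex_pairs finite_kron_vertices)
  have bounds: "0 \<le> kron_pair_prob n P e \<and> kron_pair_prob n P e \<le> 1" if "e \<in> ?U" for e
    using that kron_prob_nonneg
    by (auto simp: vertex_pairs_def kron_pair_prob_insert[OF P_commute] kron_prob_def P_nonneg P_le_1
        intro!: prod_le_1)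
  have "(\<lambda>\<omega>. {e \<in> ?U. \<omega> e}) -` {E. S \<subseteq> E} = Pi ?U (\<lambda>e. if e \<in> S then {True} else UNIV)"
    using S_subset by (auto simp: Pi_def split: if_splits)
  then have "measure_pmf.prob (kronecker_graph n P) {E. S \<subseteq> E} =
      (\<Prod>e\<in>?U. measure_pmf.prob (bernoulli_pmf (kron_pair_prob n P e)) (if e \<in> S then {True} else UNIV))"
    by (simp add: kronecker_graph_def measure_Pi_pmf_Pi[OF finite_pairs])
  also have "\<dots> = (\<Prod>e\<in>?U. if e \<in> S then kron_pair_prob n P e else 1)"
    using bounds by (intro prod.cong refl) (auto simp: measure_pmf_single)
  also have "\<dots> = (\<Prod>e\<in>S. kron_pair_prob n P e)"
    using S_subset finite_pairs by (simp add: prod.inter_restrict[symmetric] Int_absorb1)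
  finally show ?thesis .
qed

end

locale stochastic_kronecker_cycles = stochastic_kronecker +
  fixes k :: nat
  assumes three_le_k: "3 \<le> k"
begin

abbreviation cycle_count :: "nat \<Rightarrow> bool list set set \<Rightarrow> real" where
  "cycle_count n E \<equiv> real (card (cycle_copies k n E))"

lemma prod_cycle_edges:
  assumes "\<phi> \<in> cycle_embeddings k n" "I \<subseteq> {..<k}"
  shows "(\<Prod>e\<in>cycle_edge k \<phi> ` I. kron_pair_prob n P e) = (\<Prod>i\<in>I. kron_prob n P (\<phi> i) (\<phi> (Suc i mod k)))"
proof -
  have "inj_on (cycle_edge k \<phi>) I"
    using assms inj_on_cycle_edge[OF _ three_le_k] by (auto simp: cycle_embeddings_def intro: inj_on_subset)
  then show ?thesis
    by (subst prod.reindex) (simp_all add: cycle_edge_def kron_pair_prob_insert[OF P_commute])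
qed

lemma expectation_cycle_count:
  "measure_pmf.expectation (kronecker_graph n P) (cycle_count n) =
    (\<Sum>\<phi>\<in>cycle_embeddings k n. closed_walk_weight (kron_prob n P) k \<phi>)"
proof -
  have "measure_pmf.expectation (kronecker_graph n P) (cycle_count n) =
      (\<Sum>\<phi>\<in>cycle_embeddings k n. measure_pmf.prob (kronecker_graph n P) {E. cycle_edge k \<phi> ` {..<k} \<subseteq> E})"
    unfolding card_cycle_copies
    by (subst Bochner_Integration.integral_sum[OF integrable_kronecker_graph]) (simp only: expectation_of_bool)
  also have "\<dots> = (\<Sum>\<phi>\<in>cycle_embeddings k n. closed_walk_weight (kron_prob n P) k \<phi>)"
    using three_le_k
    by (intro sum.cong refl)
      (simp add: prob_edges_subset cycle_edges_subset_vertex_pairs prod_cycle_edges closed_walk_weight_def)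
  finally show ?thesis .
qed

lemma prod_union_cycle_edges:
  assumes \<phi>: "\<phi> \<in> cycle_embeddings k n" and \<psi>: "\<psi> \<in> cycle_embeddings k n"
  shows "(\<Prod>e\<in>cycle_edge k \<phi> ` {..<k} \<union> cycle_edge k \<psi> ` {..<k}. kron_pair_prob n P e) =
    union_weight (kron_prob n P) k (shared_positions k \<phi> \<psi>) \<phi> \<psi>"
proof -
  let ?J = "{..<k} - snd ` shared_positions k \<phi> \<psi>"
  have J_eq: "?J = {j. j < k \<and> cycle_edge k \<psi> j \<notin> cycle_edge k \<phi> ` {..<k}}"
    by (force simp: shared_positions_def)
  have union: "cycle_edge k \<phi> ` {..<k} \<union> cycle_edge k \<psi> ` {..<k} = cycle_edge k \<phi> ` {..<k} \<union> cycle_edge k \<psi> ` ?J"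
    and disjoint: "cycle_edge k \<phi> ` {..<k} \<inter> cycle_edge k \<psi> ` ?J = {}"
    unfolding J_eq by auto
  show ?thesis
    unfolding union
    by (subst prod.union_disjoint[OF _ _ disjoint])
      (simp_all add: prod_cycle_edges[OF \<phi>] prod_cycle_edges[OF \<psi>] union_weight_def closed_walk_weight_def)
qed

lemma expectation_cycle_count_square:
  "measure_pmf.expectation (kronecker_graph n P) (\<lambda>E. (cycle_count n E)\<^sup>2) =
    (\<Sum>(\<phi>, \<psi>)\<in>cycle_embeddings k n \<times> cycle_embeddings k n.
      union_weight (kron_prob n P) k (shared_positions k \<phi> \<psi>) \<phi> \<psi>)"
proof -
  let ?\<Phi> = "cycle_embeddings k n"
  let ?S = "\<lambda>\<phi>. cycle_edge k \<phi> ` {..<k}"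
  have square: "(cycle_count n E)\<^sup>2 = (\<Sum>x\<in>?\<Phi> \<times> ?\<Phi>. of_bool (?S (fst x) \<union> ?S (snd x) \<subseteq> E))" for E
    unfolding card_cycle_copies power2_eq_square sum_product sum.cartesian_product
    by (intro sum.cong refl) (simp add: case_prod_unfold of_bool_conj[symmetric] del: image_subset_iff)
  have "measure_pmf.expectation (kronecker_graph n P) (\<lambda>E. (cycle_count n E)\<^sup>2) =
      (\<Sum>x\<in>?\<Phi> \<times> ?\<Phi>. measure_pmf.prob (kronecker_graph n P) {E. ?S (fst x) \<union> ?S (snd x) \<subseteq> E})"
    unfolding square
    by (subst Bochner_Integration.integral_sum[OF integrable_kronecker_graph]) (simp only: expectation_of_bool)
  also have "\<dots> = (\<Sum>(\<phi>, \<psi>)\<in>?\<Phi> \<times> ?\<Phi>. union_weight (kron_prob n P) k (shared_positions k \<phi> \<psi>) \<phi> \<psi>)"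
  proof (intro sum.cong refl, clarify)
    fix \<phi> \<psi> assume embeddings: "\<phi> \<in> ?\<Phi>" "\<psi> \<in> ?\<Phi>"
    then have "?S \<phi> \<union> ?S \<psi> \<subseteq> vertex_pairs (kron_vertices n)"
      using three_le_k by (intro Un_least cycle_edges_subset_vertex_pairs) auto
    then show "measure_pmf.prob (kronecker_graph n P) {E. ?S (fst (\<phi>, \<psi>)) \<union> ?S (snd (\<phi>, \<psi>)) \<subseteq> E} =
        union_weight (kron_prob n P) k (shared_positions k \<phi> \<psi>) \<phi> \<psi>"
      by (simp only: fst_conv snd_conv prob_edges_subset prod_union_cycle_edges[OF embeddings])
  qed
  finally show ?thesis .
qed

lemma sum_cycle_embeddings_le:
  "(\<Sum>\<phi>\<in>cycle_embeddings k n. closed_walk_weight (kron_prob n P) k \<phi>) \<le> closed_walk_sum P k ^ n"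
proof -
  have "(\<Sum>\<phi>\<in>cycle_embeddings k n. closed_walk_weight (kron_prob n P) k \<phi>)
      \<le> (\<Sum>\<phi>\<in>{..<k} \<rightarrow>\<^sub>E kron_vertices n. closed_walk_weight (kron_prob n P) k \<phi>)"
    by (intro sum_mono2 finite_PiE)
      (auto simp: cycle_embeddings_def finite_kron_vertices closed_walk_weight_nonneg kron_prob_nonneg)
  then show ?thesis
    using three_le_k by (simp add: sum_closed_walk_weight_kron_prob)
qed

lemma sum_cycle_embeddings_ge:
  "closed_walk_sum P k ^ n - (\<Sum>(i, j)\<in>distinct_positions k. self_meeting_sum P k i j ^ n) \<le>
    (\<Sum>\<phi>\<in>cycle_embeddings k n. closed_walk_weight (kron_prob n P) k \<phi>)"
proof -
  let ?A = "{..<k} \<rightarrow>\<^sub>E kron_vertices n" and ?w = "closed_walk_weight (kron_prob n P) k"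
  let ?C = "\<lambda>(i, j). {\<phi> \<in> ?A. \<phi> i = \<phi> j}"
  have finite_walks: "finite ?A"
    by (intro finite_PiE) (auto simp: finite_kron_vertices)
  have "sum ?w (?A - cycle_embeddings k n) \<le> (\<Sum>y\<in>(SIGMA x:distinct_positions k. ?C x). ?w (snd y))"
  proof (rule sum_le_included[where i = snd])
    show "\<forall>\<phi>\<in>?A - cycle_embeddings k n. \<exists>y\<in>SIGMA x:distinct_positions k. ?C x. snd y = \<phi> \<and> ?w \<phi> \<le> ?w (snd y)"
      by (force simp: cycle_embeddings_def inj_on_def distinct_positions_def)
  qed (use finite_walks in \<open>auto simp: finite_distinct_positions closed_walk_weight_nonneg kron_prob_nonneg
      intro: finite_SigmaI\<close>)
  also have "\<dots> = (\<Sum>x\<in>distinct_positions k. sum ?w (?C x))"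
    using finite_walks by (subst sum.Sigma) (auto simp: finite_distinct_positions case_prod_unfold)
  also have "\<dots> = (\<Sum>(i, j)\<in>distinct_positions k. self_meeting_sum P k i j ^ n)"
    by (intro sum.cong refl) (auto simp: distinct_positions_def sum_self_meeting_walks_kron_prob)
  finally have "sum ?w (?A - cycle_embeddings k n) \<le> (\<Sum>(i, j)\<in>distinct_positions k. self_meeting_sum P k i j ^ n)" .
  moreover have "sum ?w ?A = sum ?w (?A - cycle_embeddings k n) + sum ?w (cycle_embeddings k n)"
    using finite_walks by (intro sum.subset_diff) (auto simp: cycle_embeddings_def)
  ultimately show ?thesis
    using three_le_k by (simp add: sum_closed_walk_weight_kron_prob)
qed

lemma expectation_cycle_count_asymp:
  "(\<lambda>n. measure_pmf.expectation (kronecker_graph n P) (cycle_count n) / closed_walk_sum P k ^ n) \<longlonglongrightarrow> 1"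
proof -
  let ?\<Lambda> = "closed_walk_sum P k" and ?\<mu> = "\<lambda>n. measure_pmf.expectation (kronecker_graph n P) (cycle_count n)"
  let ?\<theta> = "\<lambda>(i, j). self_meeting_sum P k i j / ?\<Lambda>"
  have lower: "1 - (\<Sum>x\<in>distinct_positions k. ?\<theta> x ^ n) \<le> ?\<mu> n / ?\<Lambda> ^ n" for n
  proof -
    have "1 - (\<Sum>x\<in>distinct_positions k. ?\<theta> x ^ n) =
        (?\<Lambda> ^ n - (\<Sum>(i, j)\<in>distinct_positions k. self_meeting_sum P k i j ^ n)) / ?\<Lambda> ^ n"
      using closed_walk_sum_pos[of k]
      by (simp add: diff_divide_distrib sum_divide_distrib power_divide case_prod_unfold)
    also have "\<dots> \<le> ?\<mu> n / ?\<Lambda> ^ n"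
      using closed_walk_sum_pos[of k] sum_cycle_embeddings_ge[of n]
      by (simp add: expectation_cycle_count divide_right_mono)
    finally show ?thesis .
  qed
  have upper: "?\<mu> n / ?\<Lambda> ^ n \<le> 1" for n
    using closed_walk_sum_pos[of k] sum_cycle_embeddings_le[of n] by (simp add: expectation_cycle_count)
  have "0 \<le> ?\<theta> x \<and> ?\<theta> x < 1" if "x \<in> distinct_positions k" for x
    using that closed_walk_sum_pos[of k] self_meeting_sum_less[of _ k _ P False True]
    by (auto simp: distinct_positions_def self_meeting_sum_nonneg P_nonneg P_pos)
  then have limit: "(\<lambda>n. 1 - (\<Sum>x\<in>distinct_positions k. ?\<theta> x ^ n)) \<longlonglongrightarrow> 1 - 0"
    by (intro tendsto_intros tendsto_sum_power_zero) auto
  show ?thesis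
    by (rule tendsto_sandwich[OF always_eventually[OF allI[OF lower]] always_eventually[OF allI[OF upper]]
          tendsto_eq_rhs[OF limit] tendsto_const]) simp
qed

lemma sum_overlapping_embeddings_le:
  "(\<Sum>(\<phi>, \<psi>)\<in>{(\<phi>, \<psi>) \<in> cycle_embeddings k n \<times> cycle_embeddings k n. shared_positions k \<phi> \<psi> \<noteq> {}}.
      union_weight (kron_prob n P) k (shared_positions k \<phi> \<psi>) \<phi> \<psi>) \<le>
    (\<Sum>\<pi>\<in>overlap_patterns k. overlap_sum P k \<pi> ^ n)"
proof -
  let ?R = "{(\<phi>, \<psi>) \<in> cycle_embeddings k n \<times> cycle_embeddings k n. shared_positions k \<phi> \<psi> \<noteq> {}}"
  let ?w = "union_weight (kron_prob n P) k"
  let ?W = "overlapping_walks k (kron_vertices n)"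
  have "(\<Sum>(\<phi>, \<psi>)\<in>?R. ?w (shared_positions k \<phi> \<psi>) \<phi> \<psi>) \<le>
      (\<Sum>(\<pi>, \<phi>, \<psi>)\<in>(SIGMA \<pi>:overlap_patterns k. ?W \<pi>). ?w (fst \<pi>) \<phi> \<psi>)"
  proof (rule sum_le_included[where i = snd])
    show "finite ?R"
      by (rule finite_subset[of _ "cycle_embeddings k n \<times> cycle_embeddings k n"])
        (auto simp: finite_cycle_embeddings)
    show "\<forall>x\<in>?R. \<exists>y\<in>SIGMA \<pi>:overlap_patterns k. ?W \<pi>. snd y = x \<and>
        (case x of (\<phi>, \<psi>) \<Rightarrow> ?w (shared_positions k \<phi> \<psi>) \<phi> \<psi>) \<le> (case y of (\<pi>, \<phi>, \<psi>) \<Rightarrow> ?w (fst \<pi>) \<phi> \<psi>)"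
    proof
      fix x assume "x \<in> ?R"
      then obtain \<phi> \<psi> where x_eq: "x = (\<phi>, \<psi>)" and embeddings: "\<phi> \<in> cycle_embeddings k n" "\<psi> \<in> cycle_embeddings k n"
        and "shared_positions k \<phi> \<psi> \<noteq> {}"
        by blast
      then obtain \<pi> where pattern: "\<pi> \<in> overlap_patterns k" "fst \<pi> = shared_positions k \<phi> \<psi>" "overlaps k \<pi> \<phi> \<psi>"
        using shared_positions_overlap_pattern[of \<phi> k \<psi>] three_le_k by (auto simp: cycle_embeddings_def)
      have "(\<phi>, \<psi>) \<in> ?W \<pi>"
        using embeddings pattern(3) by (simp add: overlapping_walks_def cycle_embeddings_def)
      with pattern show "\<exists>y\<in>SIGMA \<pi>:overlap_patterns k. ?W \<pi>. snd y = x \<and>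
          (case x of (\<phi>, \<psi>) \<Rightarrow> ?w (shared_positions k \<phi> \<psi>) \<phi> \<psi>) \<le> (case y of (\<pi>, \<phi>, \<psi>) \<Rightarrow> ?w (fst \<pi>) \<phi> \<psi>)"
        unfolding x_eq by (intro bexI[of _ "(\<pi>, \<phi>, \<psi>)"]) auto
    qed
  qed (auto simp: finite_overlap_patterns finite_overlapping_walks finite_kron_vertices
      union_weight_nonneg kron_prob_nonneg intro: finite_SigmaI)
  also have "\<dots> = (\<Sum>\<pi>\<in>overlap_patterns k. \<Sum>(\<phi>, \<psi>)\<in>?W \<pi>. ?w (fst \<pi>) \<phi> \<psi>)"
    by (simp add: sum.Sigma finite_overlap_patterns finite_overlapping_walks finite_kron_vertices case_prod_unfold)
  also have "\<dots> \<le> (\<Sum>\<pi>\<in>overlap_patterns k. overlap_sum P k \<pi> ^ n)"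
    by (intro sum_mono sum_overlapping_walks_kron_prob_le P_nonneg)
  finally show ?thesis .
qed

lemma expectation_cycle_count_square_le:
  "measure_pmf.expectation (kronecker_graph n P) (\<lambda>E. (cycle_count n E)\<^sup>2) \<le>
    (closed_walk_sum P k ^ n)\<^sup>2 + (\<Sum>\<pi>\<in>overlap_patterns k. overlap_sum P k \<pi> ^ n)"
proof -
  let ?\<Phi> = "cycle_embeddings k n"
  let ?R = "{(\<phi>, \<psi>) \<in> ?\<Phi> \<times> ?\<Phi>. shared_positions k \<phi> \<psi> \<noteq> {}}"
  let ?w = "closed_walk_weight (kron_prob n P) k"
  let ?u = "\<lambda>(\<phi>, \<psi>). union_weight (kron_prob n P) k (shared_positions k \<phi> \<psi>) \<phi> \<psi>"
  have w_nonneg: "0 \<le> ?w \<phi>" for \<phi>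
    by (simp add: closed_walk_weight_nonneg kron_prob_nonneg)
  have "sum ?u (?\<Phi> \<times> ?\<Phi> - ?R) = (\<Sum>(\<phi>, \<psi>)\<in>?\<Phi> \<times> ?\<Phi> - ?R. ?w \<phi> * ?w \<psi>)"
    by (intro sum.cong refl) (auto simp: union_weight_empty)
  also have "\<dots> \<le> (\<Sum>(\<phi>, \<psi>)\<in>?\<Phi> \<times> ?\<Phi>. ?w \<phi> * ?w \<psi>)"
    by (intro sum_mono2) (auto simp: finite_cycle_embeddings w_nonneg)
  also have "\<dots> = (sum ?w ?\<Phi>)\<^sup>2"
    by (simp add: power2_eq_square sum_product sum.cartesian_product)
  also have "\<dots> \<le> (closed_walk_sum P k ^ n)\<^sup>2"
    by (intro power_mono sum_cycle_embeddings_le sum_nonneg w_nonneg)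
  finally have "sum ?u (?\<Phi> \<times> ?\<Phi> - ?R) \<le> (closed_walk_sum P k ^ n)\<^sup>2" .
  moreover have "sum ?u (?\<Phi> \<times> ?\<Phi>) = sum ?u (?\<Phi> \<times> ?\<Phi> - ?R) + sum ?u ?R"
    by (rule sum.subset_diff) (auto simp: finite_cycle_embeddings)
  ultimately show ?thesis
    using sum_overlapping_embeddings_le[of n] by (simp add: expectation_cycle_count_square)
qed

lemma aas_no_cycle:
  assumes "closed_walk_sum P k < 1"
  shows "aas (\<lambda>n. kronecker_graph n P) (\<lambda>n E. cycle_copies k n E = {})"
proof (rule aasI_prob_ge)
  fix n
  have "cycle_copies k n E \<noteq> {} \<longleftrightarrow> 1 \<le> cycle_count n E" for E
    using finite_cycle_embeddings[of k n] by (auto simp: cycle_copies_eq Suc_le_eq card_gt_0_iff)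
  then have "measure_pmf.prob (kronecker_graph n P) {E. cycle_copies k n E \<noteq> {}} \<le>
      measure_pmf.expectation (kronecker_graph n P) (cycle_count n)"
    using integral_Markov_inequality_measure
        [of "measure_pmf (kronecker_graph n P)" "cycle_count n" "{}" 1, OF integrable_kronecker_graph]
    by simp
  also have "\<dots> \<le> closed_walk_sum P k ^ n"
    unfolding expectation_cycle_count by (rule sum_cycle_embeddings_le)
  finally have "measure_pmf.prob (kronecker_graph n P) {E. cycle_copies k n E \<noteq> {}} \<le> closed_walk_sum P k ^ n" .
  then show "1 - closed_walk_sum P k ^ n \<le> measure_pmf.prob (kronecker_graph n P) {E. cycle_copies k n E = {}}"
    unfolding prob_Collect_not by simp
  show "(\<lambda>n. closed_walk_sum P k ^ n) \<longlonglongrightarrow> 0"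
    using assms closed_walk_sum_pos[of k] by (intro LIMSEQ_power_zero) simp
qed

lemma aas_cycle_count_asymp:
  assumes "\<And>\<pi>. \<pi> \<in> overlap_patterns k \<Longrightarrow> overlap_sum P k \<pi> < (closed_walk_sum P k)\<^sup>2"
  shows "\<exists>\<delta>. \<delta> \<longlonglongrightarrow> 0 \<and> aas (\<lambda>n. kronecker_graph n P)
    (\<lambda>n E. \<exists>\<eta>. \<bar>\<eta>\<bar> \<le> \<delta> n \<and> cycle_count n E = (1 + \<eta>) * closed_walk_sum P k ^ n)"
proof (rule second_moment_imp_aas[OF finite_set_kronecker_graph])
  let ?\<Lambda> = "closed_walk_sum P k"
  let ?E = "\<lambda>n. measure_pmf.expectation (kronecker_graph n P)"
  show "?\<Lambda> ^ n \<noteq> 0" for n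
    using closed_walk_sum_pos[of k] by simp
  have expand: "?E n (\<lambda>E. (cycle_count n E / ?\<Lambda> ^ n - 1)\<^sup>2) =
      ?E n (\<lambda>E. (cycle_count n E)\<^sup>2) / (?\<Lambda> ^ n)\<^sup>2 - 2 * (?E n (cycle_count n) / ?\<Lambda> ^ n) + 1" for n
    by (simp add: power2_diff power_divide integrable_kronecker_graph)
  have upper: "?E n (\<lambda>E. (cycle_count n E / ?\<Lambda> ^ n - 1)\<^sup>2) \<le>
      2 * (1 - ?E n (cycle_count n) / ?\<Lambda> ^ n) + (\<Sum>\<pi>\<in>overlap_patterns k. (overlap_sum P k \<pi> / ?\<Lambda>\<^sup>2) ^ n)" for n
  proof -
    have "?E n (\<lambda>E. (cycle_count n E)\<^sup>2) / (?\<Lambda> ^ n)\<^sup>2 \<le>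
        ((?\<Lambda> ^ n)\<^sup>2 + (\<Sum>\<pi>\<in>overlap_patterns k. overlap_sum P k \<pi> ^ n)) / (?\<Lambda> ^ n)\<^sup>2"
      by (intro divide_right_mono expectation_cycle_count_square_le) simp
    also have "\<dots> = 1 + (\<Sum>\<pi>\<in>overlap_patterns k. (overlap_sum P k \<pi> / ?\<Lambda>\<^sup>2) ^ n)"
      using closed_walk_sum_pos[of k]
      by (simp add: add_divide_distrib sum_divide_distrib power_divide power_mult[symmetric] mult.commute)
    finally show ?thesis
      unfolding expand by simp
  qed
  have limit: "(\<lambda>n. 2 * (1 - ?E n (cycle_count n) / ?\<Lambda> ^ n) +
      (\<Sum>\<pi>\<in>overlap_patterns k. (overlap_sum P k \<pi> / ?\<Lambda>\<^sup>2) ^ n)) \<longlonglongrightarrow> 2 * (1 - 1) + 0"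
    using assms closed_walk_sum_pos[of k]
    by (intro tendsto_intros expectation_cycle_count_asymp tendsto_sum_power_zero)
      (simp_all add: overlap_sum_nonneg P_nonneg)
  show "(\<lambda>n. ?E n (\<lambda>E. (cycle_count n E / ?\<Lambda> ^ n - 1)\<^sup>2)) \<longlonglongrightarrow> 0"
    by (rule tendsto_sandwich[OF _ always_eventually[OF allI[OF upper]] tendsto_const tendsto_eq_rhs[OF limit]])
      simp_all
qed

end

section \<open>Closed walks on the group of order two\<close>

definition bool_sign :: "bool \<Rightarrow> real" where
  "bool_sign a = (if a then -1 else 1)"

lemma bool_sign_cases: "bool_sign a = 1 \<or> bool_sign a = -1"
  by (simp add: bool_sign_def)

lemma prod_bool_sign_cases: "(\<Prod>i\<in>A. bool_sign (x i)) = 1 \<or> (\<Prod>i\<in>A. bool_sign (x i)) = -1"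
  by (induction A rule: infinite_finite_induct) (use bool_sign_cases in force)+

definition signed_maps :: "'i set \<Rightarrow> real \<Rightarrow> ('i \<Rightarrow> bool) set" where
  "signed_maps A \<epsilon> = {x \<in> A \<rightarrow>\<^sub>E UNIV. (\<Prod>i\<in>A. bool_sign (x i)) = \<epsilon>}"

lemma finite_signed_maps: "finite A \<Longrightarrow> finite (signed_maps A \<epsilon>)"
  by (rule finite_subset[of _ "A \<rightarrow>\<^sub>E UNIV"]) (auto simp: signed_maps_def finite_PiE)

lemma sum_signed_maps:
  fixes g :: "'i \<Rightarrow> bool \<Rightarrow> real"
  assumes "finite A" "\<epsilon> = 1 \<or> \<epsilon> = -1"
  shows "(\<Sum>x\<in>signed_maps A \<epsilon>. \<Prod>i\<in>A. g i (x i)) =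
    ((\<Prod>i\<in>A. g i False + g i True) + \<epsilon> * (\<Prod>i\<in>A. g i False - g i True)) / 2"
proof -
  let ?X = "A \<rightarrow>\<^sub>E (UNIV :: bool set)"
  have sum_bool: "(\<Prod>i\<in>A. h i False + h i True) = (\<Sum>x\<in>?X. \<Prod>i\<in>A. h i (x i))" for h :: "'i \<Rightarrow> bool \<Rightarrow> real"
    using prod_sum_PiE[of A "\<lambda>_. UNIV" h] assms(1) by (simp add: UNIV_bool add.commute)
  have indicator: "of_bool ((\<Prod>i\<in>A. bool_sign (x i)) = \<epsilon>) = (1 + \<epsilon> * (\<Prod>i\<in>A. bool_sign (x i))) / 2" for x
    using prod_bool_sign_cases[of x A] assms(2) by auto
  have "(\<Sum>x\<in>signed_maps A \<epsilon>. \<Prod>i\<in>A. g i (x i)) =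
      (\<Sum>x\<in>?X. of_bool ((\<Prod>i\<in>A. bool_sign (x i)) = \<epsilon>) * (\<Prod>i\<in>A. g i (x i)))"
    unfolding signed_maps_def using assms(1) by (intro sum.mono_neutral_cong_left finite_PiE) auto
  also have "\<dots> = (\<Sum>x\<in>?X. (\<Prod>i\<in>A. g i (x i)) / 2 + \<epsilon> * (\<Prod>i\<in>A. bool_sign (x i) * g i (x i)) / 2)"
    by (intro sum.cong refl) (simp only: indicator prod.distrib, simp add: field_simps)
  also have "\<dots> = ((\<Sum>x\<in>?X. \<Prod>i\<in>A. g i (x i)) + \<epsilon> * (\<Sum>x\<in>?X. \<Prod>i\<in>A. bool_sign (x i) * g i (x i))) / 2"
    by (simp add: sum.distrib sum_divide_distrib[symmetric] sum_distrib_left[symmetric] add_divide_distrib)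
  also have "\<dots> = ((\<Prod>i\<in>A. g i False + g i True) + \<epsilon> * (\<Prod>i\<in>A. g i False - g i True)) / 2"
    using sum_bool[of g] sum_bool[of "\<lambda>i b. bool_sign b * g i b"] by (simp add: bool_sign_def)
  finally show ?thesis .
qed

lemma sum_signed_maps_twisted:
  fixes g :: "bool \<Rightarrow> real"
  assumes "finite A" "I \<subseteq> A"
  defines "S \<equiv> g False + g True" and "D \<equiv> g False - g True"
  shows "(\<Sum>x\<in>signed_maps A 1. (\<Prod>i\<in>I. bool_sign (x i)) * (\<Prod>i\<in>A. g (x i))) =
    (D ^ card I * S ^ card (A - I) + S ^ card I * D ^ card (A - I)) / 2"
proof -
  let ?g = "\<lambda>i b. if i \<in> I then bool_sign b * g b else g b"
  have split: "(\<Prod>i\<in>A. if i \<in> I then a i else b i) = (\<Prod>i\<in>I. a i) * (\<Prod>i\<in>A - I. b i)"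
    for a b :: "'a \<Rightarrow> real"
    using prod.subset_diff[OF assms(2,1), of "\<lambda>i. if i \<in> I then a i else b i"] assms(2)
    by (simp add: mult.commute subset_iff cong: prod.cong_simp)
  have "(\<Prod>i\<in>I. bool_sign (x i)) * (\<Prod>i\<in>A. g (x i)) = (\<Prod>i\<in>A. ?g i (x i))" for x
    using prod.subset_diff[OF assms(2,1), of "\<lambda>i. g (x i)"] by (simp add: split prod.distrib)
  then have "(\<Sum>x\<in>signed_maps A 1. (\<Prod>i\<in>I. bool_sign (x i)) * (\<Prod>i\<in>A. g (x i))) =
      ((\<Prod>i\<in>A. ?g i False + ?g i True) + (\<Prod>i\<in>A. ?g i False - ?g i True)) / 2"
    using sum_signed_maps[OF assms(1), of 1 ?g] by simp
  also have "(\<Prod>i\<in>A. ?g i False + ?g i True) = (\<Prod>i\<in>A. if i \<in> I then D else S)"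
    by (intro prod.cong refl) (simp add: S_def D_def bool_sign_def)
  also have "(\<Prod>i\<in>A. ?g i False - ?g i True) = (\<Prod>i\<in>A. if i \<in> I then S else D)"
    by (intro prod.cong refl) (simp add: S_def D_def bool_sign_def)
  finally show ?thesis
    by (simp add: split)
qed

definition steps :: "nat \<Rightarrow> (nat \<Rightarrow> bool) \<Rightarrow> nat \<Rightarrow> bool" where
  "steps k \<sigma> = (\<lambda>i\<in>{..<k}. \<sigma> i \<noteq> \<sigma> (Suc i mod k))"

lemma steps_in_signed_maps: "steps k \<sigma> \<in> signed_maps {..<k} 1"
proof (cases k)
  case (Suc m)
  have "(\<Prod>i<k. bool_sign (steps k \<sigma> i)) = (\<Prod>i<k. bool_sign (\<sigma> i)) * (\<Prod>i<k. bool_sign (\<sigma> (Suc i mod k)))"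
    unfolding prod.distrib[symmetric] by (intro prod.cong refl) (auto simp: steps_def bool_sign_def)
  also have "(\<Prod>i<k. bool_sign (\<sigma> (Suc i mod k))) = (\<Prod>i<k. bool_sign (\<sigma> i))"
    unfolding Suc by (subst (2) prod.lessThan_Suc_shift) (simp add: mult.commute)
  also have "(\<Prod>i<k. bool_sign (\<sigma> i)) * (\<Prod>i<k. bool_sign (\<sigma> i)) = 1"
    using prod_bool_sign_cases[of \<sigma> "{..<k}"] by auto
  finally show ?thesis
    by (simp add: signed_maps_def steps_def)
qed (auto simp: signed_maps_def steps_def)

lemma steps_eqD:
  assumes "\<sigma> \<in> {..<k} \<rightarrow>\<^sub>E UNIV" "\<tau> \<in> {..<k} \<rightarrow>\<^sub>E UNIV"
    and steps: "steps k \<sigma> = steps k \<tau>" and base: "r < k" "\<sigma> r = \<tau> r"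
  shows "\<sigma> = \<tau>"
proof (rule PiE_ext[OF assms(1,2)])
  have step: "\<sigma> (Suc i mod k) = \<tau> (Suc i mod k) \<longleftrightarrow> \<sigma> i = \<tau> i" if "i < k" for i
    using fun_cong[OF steps, of i] that by (auto simp: steps_def)
  have shift: "\<sigma> ((r + m) mod k) = \<tau> ((r + m) mod k)" for m
    by (induction m) (use base step[of "(r + _) mod k"] in \<open>auto simp: mod_Suc_eq\<close>)
  fix i assume "i \<in> {..<k}"
  then show "\<sigma> i = \<tau> i"
    using shift[of "k - r + i"] base by simp
qed

lemma bij_betw_base_steps:
  assumes "0 < k"
  shows "bij_betw (\<lambda>\<sigma>. (\<sigma> 0, steps k \<sigma>)) ({..<k} \<rightarrow>\<^sub>E UNIV) (UNIV \<times> signed_maps {..<k} 1)"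
proof -
  let ?h = "\<lambda>\<sigma>. (\<sigma> 0, steps k \<sigma>)" and ?A = "{..<k} \<rightarrow>\<^sub>E (UNIV :: bool set)"
  have inj: "inj_on ?h ?A"
    using steps_eqD[OF _ _ _ assms] by (auto intro: inj_onI)
  have "real (card (signed_maps {..<k} 1)) = 2 ^ k / 2"
    using sum_signed_maps[of "{..<k}" 1 "\<lambda>_ _. 1"] assms by (simp add: zero_power)
  then have "real (card (UNIV \<times> signed_maps {..<k} 1 :: (bool \<times> (nat \<Rightarrow> bool)) set)) = real (card ?A)"
    by (simp add: card_cartesian_product card_PiE)
  then have "?h ` ?A = UNIV \<times> signed_maps {..<k} 1"
    using inj steps_in_signed_maps
    by (intro card_subset_eq) (auto simp: card_image finite_signed_maps)
  with inj show ?thesis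
    by (simp add: bij_betw_def)
qed

definition step_kernel :: "(bool \<Rightarrow> real) \<Rightarrow> bool \<Rightarrow> bool \<Rightarrow> real" where
  "step_kernel g a b = g (a \<noteq> b)"

lemma closed_walk_weight_step_kernel:
  "closed_walk_weight (step_kernel g) k \<sigma> = (\<Prod>i<k. g (steps k \<sigma> i))"
  by (simp add: closed_walk_weight_def step_kernel_def steps_def)

lemma closed_walk_sum_step_kernel:
  assumes "0 < k"
  shows "closed_walk_sum (step_kernel g) k = (g False + g True) ^ k + (g False - g True) ^ k"
proof -
  have "closed_walk_sum (step_kernel g) k =
      (\<Sum>(a, x)\<in>(UNIV :: bool set) \<times> signed_maps {..<k} 1. \<Prod>i<k. g (x i))"
    unfolding closed_walk_sum_def
    by (subst sum.reindex_bij_betw[OF bij_betw_base_steps[OF assms], symmetric])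
      (simp add: closed_walk_weight_step_kernel)
  also have "\<dots> = 2 * (\<Sum>x\<in>signed_maps {..<k} 1. \<Prod>i<k. g (x i))"
    by (simp add: sum.cartesian_product[symmetric])
  finally show ?thesis
    using sum_signed_maps[of "{..<k}" 1 "\<lambda>_. g"] by simp
qed

lemma cycle_edge_eq_imp_steps_eq:
  "i < k \<Longrightarrow> j < k \<Longrightarrow> cycle_edge k \<sigma> i = cycle_edge k \<tau> j \<Longrightarrow> steps k \<sigma> i = steps k \<tau> j"
  by (auto simp: cycle_edge_def steps_def doubleton_eq_iff)

text \<open>Of two overlapping walks \<open>\<sigma>\<close> and \<open>\<tau>\<close> we record all steps of \<open>\<sigma>\<close> and the steps of \<open>\<tau>\<close> along its own edges.
  Both walks close up, so the latter have the same sign as the steps along the common edges.\<close>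

definition free_steps :: "nat \<Rightarrow> (nat \<times> nat) set \<Rightarrow> (nat \<Rightarrow> bool) \<Rightarrow> nat \<Rightarrow> bool" where
  "free_steps k M \<tau> = restrict (steps k \<tau>) ({..<k} - snd ` M)"

definition overlap_steps :: "nat \<Rightarrow> (nat \<times> nat) set \<Rightarrow> ((nat \<Rightarrow> bool) \<times> (nat \<Rightarrow> bool)) set" where
  "overlap_steps k M = (SIGMA x:signed_maps {..<k} 1.
     signed_maps ({..<k} - snd ` M) (\<Prod>i\<in>fst ` M. bool_sign (x i)))"

lemma overlapping_walks_imp_steps_eq:
  assumes pattern: "(M, r, s) \<in> overlap_patterns k" and "(\<sigma>, \<tau>) \<in> overlapping_walks k UNIV (M, r, s)" "(i, j) \<in> M"
  shows "steps k \<sigma> i = steps k \<tau> j"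
  using assms by (intro cycle_edge_eq_imp_steps_eq) (auto simp: overlap_patterns_def overlapping_walks_def)

lemma inj_on_overlap_steps:
  assumes pattern: "(M, r, s) \<in> overlap_patterns k"
  shows "inj_on (\<lambda>(\<sigma>, \<tau>). (\<sigma> r, steps k \<sigma>, free_steps k M \<tau>)) (overlapping_walks k UNIV (M, r, s))"
proof (rule inj_onI, clarify)
  fix \<sigma> \<tau> \<sigma>' \<tau>'
  assume walks: "(\<sigma>, \<tau>) \<in> overlapping_walks k UNIV (M, r, s)" "(\<sigma>', \<tau>') \<in> overlapping_walks k UNIV (M, r, s)"
    and base: "\<sigma> r = \<sigma>' r" and steps: "steps k \<sigma> = steps k \<sigma>'" and free: "free_steps k M \<tau> = free_steps k M \<tau>'"
  have "r < k" "s < k"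
    using pattern by (auto simp: overlap_patterns_def)
  then have \<sigma>_eq: "\<sigma> = \<sigma>'"
    using walks base steps by (intro steps_eqD[of \<sigma> k \<sigma>' r]) (auto simp: overlapping_walks_def)
  have "steps k \<tau> j = steps k \<tau>' j" for j
  proof (cases "j \<in> snd ` M")
    case True
    then show ?thesis
      using overlapping_walks_imp_steps_eq[OF pattern walks(1)]
        overlapping_walks_imp_steps_eq[OF pattern walks(2)] \<sigma>_eq by force
  next
    case False
    then show ?thesis
      using fun_cong[OF free, of j] by (cases "j < k") (auto simp: free_steps_def steps_def)
  qed
  then have "\<tau> = \<tau>'"
    using walks \<sigma>_eq \<open>s < k\<close> by (intro steps_eqD[of \<tau> k \<tau>' s] ext) (auto simp: overlapping_walks_def)
  with \<sigma>_eq show "\<sigma> = \<sigma>' \<and> \<tau> = \<tau>'" ..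
qed

lemma overlapping_walks_in_overlap_steps:
  assumes pattern: "(M, r, s) \<in> overlap_patterns k" and walks: "(\<sigma>, \<tau>) \<in> overlapping_walks k UNIV (M, r, s)"
  shows "(steps k \<sigma>, free_steps k M \<tau>) \<in> overlap_steps k M"
proof -
  let ?J = "{..<k} - snd ` M"
  have inj: "inj_on fst M" "inj_on snd M" and "snd ` M \<subseteq> {..<k}"
    using pattern by (auto simp: overlap_patterns_def)
  then have "1 = (\<Prod>j\<in>?J. bool_sign (steps k \<tau> j)) * (\<Prod>j\<in>snd ` M. bool_sign (steps k \<tau> j))"
    using steps_in_signed_maps[of k \<tau>]
      prod.subset_diff[of "snd ` M" "{..<k}" "\<lambda>j. bool_sign (steps k \<tau> j)"]
    by (simp add: signed_maps_def)
  also have "(\<Prod>j\<in>snd ` M. bool_sign (steps k \<tau> j)) = (\<Prod>(i, j)\<in>M. bool_sign (steps k \<sigma> i))"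
    using overlapping_walks_imp_steps_eq[OF pattern walks] inj(2) by (subst prod.reindex) (auto intro: prod.cong)
  also have "\<dots> = (\<Prod>i\<in>fst ` M. bool_sign (steps k \<sigma> i))"
    using inj(1) by (subst prod.reindex) (auto intro: prod.cong)
  finally have "(\<Prod>j\<in>?J. bool_sign (steps k \<tau> j)) = (\<Prod>i\<in>fst ` M. bool_sign (steps k \<sigma> i))"
    using prod_bool_sign_cases[of "steps k \<sigma>" "fst ` M"] by auto
  then show ?thesis
    using steps_in_signed_maps[of k \<sigma>] by (simp add: overlap_steps_def signed_maps_def free_steps_def)
qed

lemma sum_overlap_steps:
  fixes g :: "bool \<Rightarrow> real"
  assumes pattern: "(M, r, s) \<in> overlap_patterns k"
  defines "S \<equiv> g False + g True" and "D \<equiv> g False - g True" and "l \<equiv> k - card M"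
  shows "2 * (\<Sum>(x, z)\<in>overlap_steps k M. (\<Prod>i<k. g (x i)) * (\<Prod>j\<in>{..<k} - snd ` M. g (z j))) =
    S ^ card M * (S ^ (2 * l) + D ^ (2 * l)) / 2 + D ^ k * S ^ l"
proof -
  let ?I = "fst ` M" and ?J = "{..<k} - snd ` M" and ?C = "signed_maps {..<k} 1"
  let ?\<epsilon> = "\<lambda>x. \<Prod>i\<in>?I. bool_sign (x i)" and ?w = "\<lambda>x. \<Prod>i<k. g (x i)"
  have M_subset: "?I \<subseteq> {..<k}" "snd ` M \<subseteq> {..<k}" and card_M: "card ?I = card M" "card (snd ` M) = card M"
    using pattern by (auto simp: overlap_patterns_def card_image)
  have card_diff: "card ({..<k} - ?I) = l" "card ?J = l"
    using M_subset card_M by (simp_all add: l_def card_Diff_subset finite_subset)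
  have "(\<Sum>(x, z)\<in>overlap_steps k M. ?w x * (\<Prod>j\<in>?J. g (z j))) =
      (\<Sum>x\<in>?C. ?w x * (\<Sum>z\<in>signed_maps ?J (?\<epsilon> x). \<Prod>j\<in>?J. g (z j)))"
    by (simp add: overlap_steps_def sum.Sigma finite_signed_maps sum_distrib_left)
  also have "\<dots> = (\<Sum>x\<in>?C. ?w x * ((S ^ l + ?\<epsilon> x * D ^ l) / 2))"
    by (intro sum.cong refl)
      (simp add: sum_signed_maps[OF _ prod_bool_sign_cases, where g = "\<lambda>_. g"] card_diff S_def D_def)
  also have "\<dots> = (S ^ l * (\<Sum>x\<in>?C. ?w x) + D ^ l * (\<Sum>x\<in>?C. ?\<epsilon> x * ?w x)) / 2"
    by (simp add: sum_distrib_left sum.distrib[symmetric] sum_divide_distrib field_simps)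
  also have "(\<Sum>x\<in>?C. ?w x) = (S ^ k + D ^ k) / 2"
    using sum_signed_maps[of "{..<k}" 1 "\<lambda>_. g"] by (simp add: S_def D_def)
  also have "(\<Sum>x\<in>?C. ?\<epsilon> x * ?w x) = (D ^ card M * S ^ l + S ^ card M * D ^ l) / 2"
    using sum_signed_maps_twisted[of "{..<k}" ?I g] M_subset(1) card_M by (simp add: card_diff S_def D_def)
  finally have sum_eq: "(\<Sum>(x, z)\<in>overlap_steps k M. ?w x * (\<Prod>j\<in>?J. g (z j))) =
      (S ^ l * ((S ^ k + D ^ k) / 2) + D ^ l * ((D ^ card M * S ^ l + S ^ card M * D ^ l) / 2)) / 2" .
  have "k = card M + l"
    using card_mono[OF _ M_subset(1)] card_M by (simp add: l_def)
  then have power_k: "x ^ k = x ^ card M * x ^ l" for x :: real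
    by (metis power_add)
  show ?thesis
    unfolding sum_eq power_k power_even_eq power2_eq_square by (simp add: field_simps)
qed

lemma overlap_sum_step_kernel_le:
  fixes g :: "bool \<Rightarrow> real"
  assumes pattern: "(M, r, s) \<in> overlap_patterns k" and g_nonneg: "\<And>a. 0 \<le> g a"
  defines "S \<equiv> g False + g True" and "D \<equiv> g False - g True" and "l \<equiv> k - card M"
  shows "overlap_sum (step_kernel g) k (M, r, s) \<le>
    S ^ card M * (S ^ (2 * l) + D ^ (2 * l)) / 2 + D ^ k * S ^ l"
proof -
  let ?W = "overlapping_walks k UNIV (M, r, s)"
  let ?h = "\<lambda>(\<sigma>, \<tau>). (\<sigma> r, steps k \<sigma>, free_steps k M \<tau>)"
  let ?w = "\<lambda>(x, z). (\<Prod>i<k. g (x i)) * (\<Prod>j\<in>{..<k} - snd ` M. g (z j))"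
  have "overlap_sum (step_kernel g) k (M, r, s) = (\<Sum>y\<in>?W. ?w (snd (?h y)))"
    unfolding overlap_sum_def union_weight_def closed_walk_weight_step_kernel
    by (intro sum.cong refl) (auto simp: step_kernel_def free_steps_def steps_def)
  also have "\<dots> = (\<Sum>y\<in>?h ` ?W. ?w (snd y))"
    by (simp only: sum.reindex[OF inj_on_overlap_steps[OF pattern]] comp_def)
  also have "\<dots> \<le> (\<Sum>y\<in>(UNIV :: bool set) \<times> overlap_steps k M. ?w (snd y))"
  proof (rule sum_mono2)
    show "finite ((UNIV :: bool set) \<times> overlap_steps k M)"
      by (simp add: overlap_steps_def finite_signed_maps)
    show "?h ` ?W \<subseteq> UNIV \<times> overlap_steps k M"
      using overlapping_walks_in_overlap_steps[OF pattern] by auto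
    show "0 \<le> ?w (snd y)" for y :: "bool \<times> _"
      using g_nonneg by (auto simp: case_prod_unfold intro!: mult_nonneg_nonneg prod_nonneg)
  qed
  also have "\<dots> = 2 * (\<Sum>y\<in>overlap_steps k M. ?w y)"
    using sum.cartesian_product[of "\<lambda>_. ?w" "overlap_steps k M" "UNIV :: bool set"]
    by (simp add: case_prod_unfold)
  also have "\<dots> = S ^ card M * (S ^ (2 * l) + D ^ (2 * l)) / 2 + D ^ k * S ^ l"
    unfolding S_def D_def l_def by (rule sum_overlap_steps[OF pattern])
  finally show ?thesis .
qed

section \<open>The exponent of an overlap\<close>

lemma overlap_exponent_less_nonneg:
  fixes s d :: real
  assumes "\<bar>d\<bar> \<le> s" "1 \<le> j" "0 \<le> d ^ (j + l)" "1 < s ^ (j + l) + d ^ (j + l)"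
  shows "s ^ j * (s ^ (2 * l) + d ^ (2 * l)) / 2 + d ^ (j + l) * s ^ l < (s ^ (j + l) + d ^ (j + l))\<^sup>2"
proof -
  let ?\<Lambda> = "s ^ (j + l) + d ^ (j + l)"
  have s_nonneg: "0 \<le> s"
    using assms(1) by linarith
  have "d ^ (2 * l) \<le> s ^ (2 * l)"
    using assms(1) power_mono[of "\<bar>d\<bar>" s "2 * l"] by (simp add: power_even_abs)
  then have "s ^ j * (s ^ (2 * l) + d ^ (2 * l)) \<le> s ^ j * (2 * s ^ (2 * l))"
    using s_nonneg by (intro mult_left_mono) auto
  then have "s ^ j * (s ^ (2 * l) + d ^ (2 * l)) / 2 + d ^ (j + l) * s ^ l \<le>
      s ^ j * s ^ (2 * l) + d ^ (j + l) * s ^ l"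
    by simp
  also have "\<dots> = s ^ l * ?\<Lambda>"
    unfolding mult_2 power_add by (simp only: distrib_left mult_ac)
  also have "s ^ l < ?\<Lambda>"
  proof (cases "s \<le> 1")
    case True
    then show ?thesis
      using assms(4) s_nonneg power_le_one[of s l] by linarith
  next
    case False
    then have "s ^ l < s ^ (j + l)"
      using assms(2) by (intro power_strict_increasing) auto
    then show ?thesis
      using assms(3) by linarith
  qed
  then have "s ^ l * ?\<Lambda> < ?\<Lambda>\<^sup>2"
    using assms(4) by (simp add: power2_eq_square)
  finally show ?thesis .
qed

text \<open>For negative \<open>d = - a\<close> and odd \<open>k\<close>, \<open>s ^ l\<close> can exceed \<open>s ^ k - a ^ k\<close>, so the previous estimate is too crude.
  Write \<open>p, q, m, n\<close> for \<open>s ^ l, a ^ l, s ^ j, a ^ j\<close>. The difference of the two sides is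
  \<open>L\<^sup>2 - L * (p + q) / 2 + q * (p - q) * (m + n) / 2\<close> with \<open>L = p * m - q * n\<close>. As \<open>L > 1\<close> and \<open>L \<ge> p - q\<close>, it
  is compared with its value at \<open>L = 1\<close> if \<open>p \<le> 2 + q\<close> and at \<open>L = p - q\<close> otherwise.\<close>

lemma mixed_product_less_square:
  fixes p q m n :: real
  assumes "0 < q" "q \<le> 1" "q \<le> p" "0 < n" "n \<le> 1" "1 \<le> m" and "1 < p * m - q * n"
  shows "m * (p\<^sup>2 + q\<^sup>2) / 2 - n * q * p < (p * m - q * n)\<^sup>2"
proof -
  define L where "L = p * m - q * n"
  have L_bounds: "1 < L" "p - q \<le> L"
    using mult_left_mono[of 1 m p] mult_left_mono[of n 1 q] assms by (auto simp: L_def intro: diff_mono)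
  have mn_bound: "q * (p - q) * 1 \<le> q * (p - q) * (m + n)"
    using assms by (intro mult_left_mono) auto
  have "0 < L\<^sup>2 - L * (p + q) / 2 + q * (p - q) * (m + n) / 2"
  proof (cases "p \<le> 2 + q")
    case True
    then have "0 < (L - 1) * (L + 1 - (p + q) / 2)"
      using L_bounds assms by (intro mult_pos_pos) auto
    moreover have "0 \<le> (1 - q) * (2 + q - p) / 2"
      using True assms by simp
    ultimately show ?thesis
      using mn_bound by (simp add: power2_eq_square field_simps)
  next
    case False
    then have "0 \<le> (L - (p - q)) * (L + (p - q) - (p + q) / 2)"
      using L_bounds assms by (intro mult_nonneg_nonneg) auto
    moreover have "0 < (p - q) * (p - 2 * q) / 2"
      using False assms by simp
    ultimately show ?thesis
      using mn_bound by (simp add: power2_eq_square field_simps)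
  qed
  also have "\<dots> = (p * m - q * n)\<^sup>2 - (m * (p\<^sup>2 + q\<^sup>2) / 2 - n * q * p)"
    by (simp add: L_def power2_eq_square field_simps)
  finally show ?thesis
    by simp
qed

lemma overlap_exponent_less_odd:
  fixes s a :: real
  assumes a_bounds: "0 < a" "a < s" "a < 1" and gt_1: "1 < s ^ (j + l) - a ^ (j + l)"
  shows "s ^ j * (s ^ (2 * l) + a ^ (2 * l)) / 2 - a ^ (j + l) * s ^ l < (s ^ (j + l) - a ^ (j + l))\<^sup>2"
proof -
  have "1 < s"
  proof (rule ccontr)
    assume "\<not> 1 < s"
    then have "s ^ (j + l) \<le> 1"
      using a_bounds by (intro power_le_one) auto
    with gt_1 zero_less_power[OF a_bounds(1), of "j + l"] show False
      by linarith
  qed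
  then have "s ^ j * ((s ^ l)\<^sup>2 + (a ^ l)\<^sup>2) / 2 - a ^ j * a ^ l * s ^ l < (s ^ l * s ^ j - a ^ l * a ^ j)\<^sup>2"
    using a_bounds gt_1
    by (intro mixed_product_less_square) (auto simp: power_add mult.commute intro: power_le_one power_mono)
  then show ?thesis
    by (simp add: power_add power_mult[symmetric] mult_ac)
qed

lemma overlap_exponent_less:
  fixes s d :: real
  assumes "\<bar>d\<bar> < s" "\<bar>d\<bar> < 1" "1 \<le> j" and gt_1: "1 < s ^ (j + l) + d ^ (j + l)"
  shows "s ^ j * (s ^ (2 * l) + d ^ (2 * l)) / 2 + d ^ (j + l) * s ^ l < (s ^ (j + l) + d ^ (j + l))\<^sup>2"
proof (cases "0 \<le> d ^ (j + l)")
  case True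
  with assms show ?thesis
    by (intro overlap_exponent_less_nonneg) auto
next
  case False
  then have "d < 0" "odd (j + l)"
    using zero_le_power_eq[of d "j + l"] by auto
  then have d_power: "d ^ (j + l) = - ((- d) ^ (j + l))" "d ^ (2 * l) = (- d) ^ (2 * l)"
    using power_minus_odd[of "j + l" d] by simp_all
  have "0 < - d" "- d < s" "- d < 1"
    using \<open>d < 0\<close> assms by auto
  from overlap_exponent_less_odd[OF this, of j l] show ?thesis
    using gt_1 unfolding d_power by simp
qed

lemma overlap_sum_step_kernel_less:
  fixes g :: "bool \<Rightarrow> real"
  assumes pattern: "\<pi> \<in> overlap_patterns k" and g_bounds: "\<And>a. 0 < g a" "\<And>a. g a < 1"
    and gt_1: "1 < closed_walk_sum (step_kernel g) k"
  shows "overlap_sum (step_kernel g) k \<pi> < (closed_walk_sum (step_kernel g) k)\<^sup>2"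
proof -
  obtain M r s where \<pi>_eq: "\<pi> = (M, r, s)"
    by (cases \<pi>)
  have "finite M" and "M \<noteq> {}" and "inj_on fst M" and "fst ` M \<subseteq> {..<k}" and "0 < k"
    using pattern finite_subset[of M "{..<k} \<times> {..<k}"] by (auto simp: \<pi>_eq overlap_patterns_def)
  then have card_M: "1 \<le> card M" "card M + (k - card M) = k"
    using card_mono[of "{..<k}" "fst ` M"] by (simp_all add: card_image Suc_le_eq card_gt_0_iff)
  let ?S = "g False + g True" and ?D = "g False - g True" and ?l = "k - card M"
  have closed_walk_sum_eq: "closed_walk_sum (step_kernel g) k = ?S ^ k + ?D ^ k"
    using \<open>0 < k\<close> by (rule closed_walk_sum_step_kernel)
  have "overlap_sum (step_kernel g) k \<pi> \<le> ?S ^ card M * (?S ^ (2 * ?l) + ?D ^ (2 * ?l)) / 2 + ?D ^ k * ?S ^ ?l"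
    using pattern g_bounds(1) unfolding \<pi>_eq by (intro overlap_sum_step_kernel_le) (auto simp: less_imp_le)
  also have "\<dots> < (?S ^ k + ?D ^ k)\<^sup>2"
    using overlap_exponent_less[of ?D ?S "card M" ?l] gt_1 card_M
      g_bounds(1)[of False] g_bounds(1)[of True] g_bounds(2)[of False] g_bounds(2)[of True]
    by (simp add: closed_walk_sum_eq)
  finally show ?thesis
    unfolding closed_walk_sum_eq .
qed

section \<open>The threshold\<close>

lemma initiator_eq_step_kernel: "initiator \<alpha> \<beta> \<alpha> = step_kernel (\<lambda>a. if a then \<beta> else \<alpha>)"
  by (auto simp: initiator_def step_kernel_def fun_eq_iff)

lemma closed_walk_sum_initiator:
  "0 < k \<Longrightarrow> closed_walk_sum (initiator \<alpha> \<beta> \<alpha>) k = (\<alpha> + \<beta>) ^ k + (\<alpha> - \<beta>) ^ k"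
  by (simp add: initiator_eq_step_kernel closed_walk_sum_step_kernel)

theorem theorem3:
  fixes \<alpha> \<beta> \<gamma> :: real and k :: nat
  assumes "0 < \<alpha>" "\<alpha> < 1" "0 < \<beta>" "\<beta> < 1" "0 < \<gamma>" "\<gamma> < 1"
    and "\<alpha> = \<gamma>"
    and "k \<ge> 3"
  shows "((\<alpha> + \<beta>) ^ k + (\<alpha> - \<beta>) ^ k < 1 \<longrightarrow>
            aas (\<lambda>n. kronecker_graph n (initiator \<alpha> \<beta> \<gamma>)) (\<lambda>n E. cycle_copies k n E = {})) \<and>
         ((\<alpha> + \<beta>) ^ k + (\<alpha> - \<beta>) ^ k > 1 \<longrightarrow>
            (\<exists>\<delta> :: nat \<Rightarrow> real. \<delta> \<longlonglongrightarrow> 0 \<and>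
               aas (\<lambda>n. kronecker_graph n (initiator \<alpha> \<beta> \<gamma>))
                 (\<lambda>n E. \<exists>\<eta> :: real. \<bar>\<eta>\<bar> \<le> \<delta> n \<and>
                    real (card (cycle_copies k n E)) =
                      (1 + \<eta>) * ((\<alpha> + \<beta>) ^ k + (\<alpha> - \<beta>) ^ k) ^ n)))"
proof -
  let ?P = "initiator \<alpha> \<beta> \<alpha>"
  interpret stochastic_kronecker_cycles ?P k
    using assms by unfold_locales (auto simp: initiator_def)
  have closed_walk_sum_eq: "closed_walk_sum ?P k = (\<alpha> + \<beta>) ^ k + (\<alpha> - \<beta>) ^ k"
    using assms(8) by (intro closed_walk_sum_initiator) simp
  have "overlap_sum ?P k \<pi> < (closed_walk_sum ?P k)\<^sup>2"
    if "\<pi> \<in> overlap_patterns k" "1 < closed_walk_sum ?P k" for \<pi>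
    using that assms(1-4) unfolding initiator_eq_step_kernel
    by (intro overlap_sum_step_kernel_less) auto
  then show ?thesis
    using aas_no_cycle aas_cycle_count_asymp unfolding \<open>\<alpha> = \<gamma>\<close>[symmetric] closed_walk_sum_eq by blast
qed

end
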